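(* Let $H,K,U$, $A,B,R,Q,Q_T,\overline Q,\overline Q_T,S,S_T,\sigma$, $T>0$ and $z_0\in H$ be as in the context. Assume that: (a) $-\overline Q_TS_T\in\Sigma^+(H)$ and $-\overline QS\in\Sigma^+(H)$; (b) for every $x\in H$: $\langle\overline Q_TS_Tx,x\rangle_H=0$ implies $\overline Q_TS_Tx=0$, and $\langle\overline QSx,x\rangle_H=0$ implies $\overline QSx=0$. Then the LQM mild solution to the mean field game is unique (that is, there is at most one LQM mild solution $(P,r,z,s)$).
   Context: $H,K,U$ are separable real Hilbert spaces. $\mathcal L(\cdot;\cdot)$ denotes bounded linear operators with the operator norm, $\mathcal L(H)=\mathcal L(H;H)$; $\Sigma(H)$ is the set of self-adjoint operators in $\mathcal L(H)$, $\Sigma^+(H)$ the set of nonnegative ones in $\Sigma(H)$ (similarly for $U$). Standing assumptions: $A:D(A)\subset H\to H$ is closed, densely defined and generates a $C_0$-semigroup $(e^{tA})_{t\ge0}$ on $H$; $B\in\mathcal L(U;H)$; $Q,Q_T\in\Sigma^+(H)$; $\overline Q,\overline Q_T\in\Sigma(H)$; $Q+\overline Q,\ Q_T+\overline Q_T\in\Sigma^+(H)$; $R\in\Sigma(U)$ with $\langle R\alpha,\alpha\rangle_U\ge\varepsilon|\alpha|_U^2$ for all $\alpha\in U$ and some $\varepsilon>0$; $S,S_T\in\mathcal L(H)$; $\sigma\in\mathcal L(K;H)$; $T>0$; $z_0\in H$ (the mean $z_0=\int_H x\,m_0(dx)$ of the initial distribution $m_0$ of the agents). $C_s([0,T];\Sigma^+(H))$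 is the space of strongly continuous maps $f:[0,T]\to\Sigma^+(H)$, i.e. $t\mapsto f(t)x$ is continuous for each $x\in H$. LQM (Linear-Quadratic-Mean) mild solution to the mean field game: a 4-tuple $(P,r,z,s)\in C_s([0,T];\Sigma^+(H))\times C([0,T];H)\times C([0,T];H)\times C([0,T];\mathbb R)$ such that, for all $x\in H$ and $t\in[0,T]$, $$P(t)x=e^{(T-t)A^*}(Q_T+\overline Q_T)e^{(T-t)A}x+\int_t^Te^{(s-t)A^*}(Q+\overline Q)e^{(s-t)A}x\,ds-\int_t^Te^{(s-t)A^*}P(s)BR^{-1}B^*P(s)e^{(s-t)A}x\,ds$$ (it is known that there is exactly one such $P$); $$z(t)=e^{tA}z_0-\int_0^te^{(t-s)A}BR^{-1}B^*P(s)z(s)\,ds-\int_0^te^{(t-s)A}BR^{-1}B^*r(s)\,ds,$$ $$r(t)=-e^{(T-t)A^*}\overline Q_TS_Tz(T)-\int_t^Te^{(s-t)A^*}P(s)BR^{-1}B^*r(s)\,ds-\int_t^Te^{(s-t)A^*}\overline QSz(s)\,ds;$$ and $$s(t)=\tfrac12\langle\overline Q_TS_Tz(T),S_Tz(T)\rangle_H+\int_t^T\Big[\tfrac12\mathrm{Tr}[\sigma\sigma^*P(u)]-\tfrac12\langle BR^{-1}B^*r(u),r(u)\rangle_H+\tfrac12\langle\overline QSz(u),Sz(u)\rangle_H\Big]du .$$ *)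

theory Defs
  imports "HOL-Analysis.Analysis"
begin

text \<open>
  Separable real Hilbert spaces are types of sort
  \<open>{real_inner, banach, second_countable_topology}\<close>; bounded operators are
  elements of the type \<open>'a \<Rightarrow>\<^sub>L 'b\<close>. The Hilbert space adjoint is the library function
  \<^const>\<open>adjoint\<close>, which is characterised by a choice operator; the operator chosen exists
  and is unique by the Riesz representation theorem.
\<close>

definition selfadjoint :: "('a::real_inner \<Rightarrow>\<^sub>L 'a) \<Rightarrow> bool" where
  "selfadjoint M \<longleftrightarrow> (\<forall>x y. M x \<bullet> y = x \<bullet> M y)"

definition nonneg_selfadjoint :: "('a::real_inner \<Rightarrow>\<^sub>L 'a) \<Rightarrow> bool" where
  "nonneg_selfadjoint M \<longleftrightarrow> selfadjoint M \<and> (\<forall>x. 0 \<le> M x \<bullet> x)"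

text \<open>Only the values \<open>E t\<close> with \<open>t \<ge> 0\<close> are meaningful.\<close>

definition C0_semigroup :: "(real \<Rightarrow> 'a::real_normed_vector \<Rightarrow>\<^sub>L 'a) \<Rightarrow> bool" where
  "C0_semigroup E \<longleftrightarrow>
     E 0 = id_blinfun \<and>
     (\<forall>t\<ge>0. \<forall>u\<ge>0. E (t + u) = E t o\<^sub>L E u) \<and>
     (\<forall>x. continuous_on {0..} (\<lambda>t. E t x))"

text \<open>
  An unbounded operator is given by its domain \<open>D\<close> together with a function \<open>A\<close> whose values
  outside \<open>D\<close> are irrelevant.
\<close>

definition linear_operator_on :: "'a::real_vector set \<Rightarrow> ('a \<Rightarrow> 'a) \<Rightarrow> bool" where
  "linear_operator_on D A \<longleftrightarrow>
     subspace D \<and>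
     (\<forall>x\<in>D. \<forall>y\<in>D. A (x + y) = A x + A y) \<and>
     (\<forall>c. \<forall>x\<in>D. A (c *\<^sub>R x) = c *\<^sub>R A x)"

definition closed_operator :: "'a::real_normed_vector set \<Rightarrow> ('a \<Rightarrow> 'a) \<Rightarrow> bool" where
  "closed_operator D A \<longleftrightarrow> closed {(x, A x) | x. x \<in> D}"

definition generates ::
    "'a::real_normed_vector set \<Rightarrow> ('a \<Rightarrow> 'a) \<Rightarrow> (real \<Rightarrow> 'a \<Rightarrow>\<^sub>L 'a) \<Rightarrow> bool" where
  "generates D A E \<longleftrightarrow>
     D = {x. \<exists>y. ((\<lambda>h. (E h x - x) /\<^sub>R h) \<longlongrightarrow> y) (at_right 0)} \<and>
     (\<forall>x\<in>D. ((\<lambda>h. (E h x - x) /\<^sub>R h) \<longlongrightarrow> A x) (at_right 0))"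

definition orthonormal_basis :: "'a::real_inner set \<Rightarrow> bool" where
  "orthonormal_basis X \<longleftrightarrow>
     pairwise orthogonal X \<and> (\<forall>e\<in>X. norm e = 1) \<and> closure (span X) = UNIV"

text \<open>Trace class (nuclear) operators, and the trace as the basis independent value of
  \<open>\<Sum>\<langle>M e, e\<rangle>\<close>.\<close>

definition trace_class :: "('a::real_inner \<Rightarrow> 'a) \<Rightarrow> bool" where
  "trace_class M \<longleftrightarrow>
     (\<exists>a b :: nat \<Rightarrow> 'a. summable (\<lambda>n. norm (a n) * norm (b n)) \<and>
        (\<forall>x. (\<lambda>n. (x \<bullet> a n) *\<^sub>R b n) sums M x))"

definition op_trace :: "('a::real_inner \<Rightarrow> 'a) \<Rightarrow> real" where
  "op_trace M = (THE c. \<forall>X. orthonormal_basis X \<longrightarrow> ((\<lambda>e. M e \<bullet> e) has_sum c) X)"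

text \<open>The operator \<open>B R\<^sup>-\<^sup>1 B\<^sup>*\<close>.\<close>

definition BRB ::
    "('u::real_inner \<Rightarrow>\<^sub>L 'h::real_inner) \<Rightarrow> ('u \<Rightarrow>\<^sub>L 'u) \<Rightarrow> 'h \<Rightarrow> 'h" where
  "BRB B R y = B (inv (blinfun_apply R) (adjoint (blinfun_apply B) y))"

text \<open>
  Integrals of Hilbert space valued functions are Bochner integrals. Functions on \<open>[0,T]\<close> are
  represented by functions on \<^typ>\<open>real\<close>; only their values on \<open>[0,T]\<close> are constrained.
\<close>

definition riccati_mild_solution ::
    "(real \<Rightarrow> 'h::{real_inner,banach,second_countable_topology} \<Rightarrow>\<^sub>L 'h) \<Rightarrow>
     ('u::{real_inner,banach,second_countable_topology} \<Rightarrow>\<^sub>L 'h) \<Rightarrow> ('u \<Rightarrow>\<^sub>L 'u) \<Rightarrow>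
     ('h \<Rightarrow>\<^sub>L 'h) \<Rightarrow> ('h \<Rightarrow>\<^sub>L 'h) \<Rightarrow> ('h \<Rightarrow>\<^sub>L 'h) \<Rightarrow> ('h \<Rightarrow>\<^sub>L 'h) \<Rightarrow> real \<Rightarrow>
     (real \<Rightarrow> 'h \<Rightarrow>\<^sub>L 'h) \<Rightarrow> bool" where
  "riccati_mild_solution E B R Q QT Qb QbT T P \<longleftrightarrow>
     (\<forall>x. \<forall>t\<in>{0..T}.
        P t x =
          adjoint (E (T - t)) ((QT + QbT) (E (T - t) x))
          + (LBINT u:{t..T}. adjoint (E (u - t)) ((Q + Qb) (E (u - t) x)))
          - (LBINT u:{t..T}. adjoint (E (u - t)) (P u (BRB B R (P u (E (u - t) x))))))"

definition mean_mild_equation ::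
    "(real \<Rightarrow> 'h::{real_inner,banach,second_countable_topology} \<Rightarrow>\<^sub>L 'h) \<Rightarrow>
     ('u::{real_inner,banach,second_countable_topology} \<Rightarrow>\<^sub>L 'h) \<Rightarrow> ('u \<Rightarrow>\<^sub>L 'u) \<Rightarrow>
     real \<Rightarrow> 'h \<Rightarrow> (real \<Rightarrow> 'h \<Rightarrow>\<^sub>L 'h) \<Rightarrow> (real \<Rightarrow> 'h) \<Rightarrow> (real \<Rightarrow> 'h) \<Rightarrow> bool" where
  "mean_mild_equation E B R T z0 P r z \<longleftrightarrow>
     (\<forall>t\<in>{0..T}.
        z t =
          E t z0
          - (LBINT u:{0..t}. E (t - u) (BRB B R (P u (z u))))
          - (LBINT u:{0..t}. E (t - u) (BRB B R (r u))))"

definition adjoint_mild_equation ::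
    "(real \<Rightarrow> 'h::{real_inner,banach,second_countable_topology} \<Rightarrow>\<^sub>L 'h) \<Rightarrow>
     ('u::{real_inner,banach,second_countable_topology} \<Rightarrow>\<^sub>L 'h) \<Rightarrow> ('u \<Rightarrow>\<^sub>L 'u) \<Rightarrow>
     ('h \<Rightarrow>\<^sub>L 'h) \<Rightarrow> ('h \<Rightarrow>\<^sub>L 'h) \<Rightarrow> ('h \<Rightarrow>\<^sub>L 'h) \<Rightarrow> ('h \<Rightarrow>\<^sub>L 'h) \<Rightarrow> real \<Rightarrow>
     (real \<Rightarrow> 'h \<Rightarrow>\<^sub>L 'h) \<Rightarrow> (real \<Rightarrow> 'h) \<Rightarrow> (real \<Rightarrow> 'h) \<Rightarrow> bool" where
  "adjoint_mild_equation E B R Qb QbT S ST T P r z \<longleftrightarrow>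
     (\<forall>t\<in>{0..T}.
        r t =
          - adjoint (E (T - t)) (QbT (ST (z T)))
          - (LBINT u:{t..T}. adjoint (E (u - t)) (P u (BRB B R (r u))))
          - (LBINT u:{t..T}. adjoint (E (u - t)) (Qb (S (z u)))))"

text \<open>
  The operator \<open>\<sigma>\<sigma>\<^sup>*P(u)\<close> need not be trace class when \<open>\<sigma>\<close> is merely bounded. The first two
  conjuncts say that the trace term is meaningful, i.e. that the trace exists for almost every
  \<open>u\<close> and is integrable; the other terms of the integrand are continuous in \<open>u\<close>.
\<close>

definition scalar_equation ::
    "('u::{real_inner,banach,second_countable_topology} \<Rightarrow>\<^sub>L
        'h::{real_inner,banach,second_countable_topology}) \<Rightarrow> ('u \<Rightarrow>\<^sub>L 'u) \<Rightarrow>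
     ('h \<Rightarrow>\<^sub>L 'h) \<Rightarrow> ('h \<Rightarrow>\<^sub>L 'h) \<Rightarrow> ('h \<Rightarrow>\<^sub>L 'h) \<Rightarrow> ('h \<Rightarrow>\<^sub>L 'h) \<Rightarrow>
     ('k::{real_inner,banach,second_countable_topology} \<Rightarrow>\<^sub>L 'h) \<Rightarrow> real \<Rightarrow>
     (real \<Rightarrow> 'h \<Rightarrow>\<^sub>L 'h) \<Rightarrow> (real \<Rightarrow> 'h) \<Rightarrow> (real \<Rightarrow> 'h) \<Rightarrow> (real \<Rightarrow> real) \<Rightarrow> bool" where
  "scalar_equation B R Qb QbT S ST \<sigma> T P r z s \<longleftrightarrow>
     (AE u in lborel. u \<in> {0..T} \<longrightarrow> trace_class (\<lambda>x. \<sigma> (adjoint \<sigma> (P u x)))) \<and>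
     set_integrable lborel {0..T} (\<lambda>u. op_trace (\<lambda>x. \<sigma> (adjoint \<sigma> (P u x)))) \<and>
     (\<forall>t\<in>{0..T}.
        s t =
          1/2 * (QbT (ST (z T)) \<bullet> ST (z T))
          + (LBINT u:{t..T}.
               1/2 * op_trace (\<lambda>x. \<sigma> (adjoint \<sigma> (P u x)))
               - 1/2 * (BRB B R (r u) \<bullet> r u)
               + 1/2 * (Qb (S (z u)) \<bullet> S (z u))))"

definition LQM_mild_solution ::
    "(real \<Rightarrow> 'h::{real_inner,banach,second_countable_topology} \<Rightarrow>\<^sub>L 'h) \<Rightarrow>
     ('u::{real_inner,banach,second_countable_topology} \<Rightarrow>\<^sub>L 'h) \<Rightarrow> ('u \<Rightarrow>\<^sub>L 'u) \<Rightarrow>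
     ('h \<Rightarrow>\<^sub>L 'h) \<Rightarrow> ('h \<Rightarrow>\<^sub>L 'h) \<Rightarrow> ('h \<Rightarrow>\<^sub>L 'h) \<Rightarrow> ('h \<Rightarrow>\<^sub>L 'h) \<Rightarrow>
     ('h \<Rightarrow>\<^sub>L 'h) \<Rightarrow> ('h \<Rightarrow>\<^sub>L 'h) \<Rightarrow>
     ('k::{real_inner,banach,second_countable_topology} \<Rightarrow>\<^sub>L 'h) \<Rightarrow> real \<Rightarrow> 'h \<Rightarrow>
     (real \<Rightarrow> 'h \<Rightarrow>\<^sub>L 'h) \<Rightarrow> (real \<Rightarrow> 'h) \<Rightarrow> (real \<Rightarrow> 'h) \<Rightarrow> (real \<Rightarrow> real) \<Rightarrow> bool" where
  "LQM_mild_solution E B R Q QT Qb QbT S ST \<sigma> T z0 P r z s \<longleftrightarrow>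
     (\<forall>t\<in>{0..T}. nonneg_selfadjoint (P t)) \<and>
     (\<forall>x. continuous_on {0..T} (\<lambda>t. P t x)) \<and>
     continuous_on {0..T} r \<and> continuous_on {0..T} z \<and> continuous_on {0..T} s \<and>
     riccati_mild_solution E B R Q QT Qb QbT T P \<and>
     mean_mild_equation E B R T z0 P r z \<and>
     adjoint_mild_equation E B R Qb QbT S ST T P r z \<and>
     scalar_equation B R Qb QbT S ST \<sigma> T P r z s"

end

theory Submission
  imports Defs
begin

text \<open>
  Write \<open>G = B R\<^sup>-\<^sup>1 B\<^sup>*\<close>. The components of an LQM mild solution are determined one after the
  other.

  The Riccati equation involves \<open>P\<close> alone. The difference of two solutions satisfies a linear
  Volterra inequality backward from \<open>T\<close>, with coefficients that are bounded by the uniform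
  boundedness principle, so it vanishes by Gronwall (\<open>riccati_unique\<close>).

  With \<open>P\<close> fixed, the equations for \<open>z\<close> and \<open>r\<close> are affine, and the differences \<open>\<delta>z\<close> and \<open>\<delta>r\<close> of
  two solutions solve the homogeneous system
  \<open>\<delta>z' = A \<delta>z - G P \<delta>z - G \<delta>r\<close>, \<open>\<delta>z(0) = 0\<close>, and
  \<open>\<delta>r' = - A\<^sup>* \<delta>r + P G \<delta>r + Qb S \<delta>z\<close>, \<open>\<delta>r(T) = - QbT ST \<delta>z(T)\<close>, in mild form.
  Formally, the derivative of \<open>\<langle>\<delta>r, \<delta>z\<rangle>\<close> is \<open>\<langle>Qb S \<delta>z, \<delta>z\<rangle> - \<langle>G \<delta>r, \<delta>r\<rangle>\<close>, because the terms with
  \<open>A\<close> and with \<open>P\<close> cancel. Integrating over \<open>[0,T]\<close> gives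
  \<open>\<langle>- QbT ST \<delta>z(T), \<delta>z(T)\<rangle> + \<integral> \<langle>- Qb S \<delta>z, \<delta>z\<rangle> + \<integral> \<langle>G \<delta>r, \<delta>r\<rangle> = 0\<close>,
  a sum of three nonnegative terms (\<open>mild_duality\<close> proves the integrated identity for mild
  solutions). So each of them vanishes; by the kernel conditions and the coercivity of \<open>R\<close> this
  means \<open>QbT ST \<delta>z(T) = 0\<close>, \<open>Qb S \<delta>z = 0\<close> and \<open>G \<delta>r = 0\<close>. The equation for \<open>\<delta>r\<close> then reads
  \<open>\<delta>r = 0\<close>, and \<open>\<delta>z = 0\<close> follows from Gronwall (\<open>homogeneous_forward_backward_trivial\<close>).

  Finally \<open>s\<close> is given explicitly by \<open>P\<close>, \<open>r\<close> and \<open>z\<close>.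

  Since the adjoint of a strongly continuous family is directly seen to be only weakly continuous,
  the integrals that contain adjoints are handled with Pettis' measurability theorem
  (\<open>set_integrable_weakly_continuous\<close>).
\<close>

section \<open>Coercive operators and adjoints on Hilbert spaces\<close>

lemma quadratic_perturbation_zero:
  fixes a b :: real
  assumes "\<And>t. 0 \<le> t * a + t\<^sup>2 * b"
  shows "a = 0"
proof (rule ccontr)
  assume "a \<noteq> 0"
  define c where "c = \<bar>b\<bar> + 1"
  have c: "c > 0" "b < c" by (auto simp: c_def)
  \<comment> \<open>The linear term dominates for small \<open>t\<close> of sign opposite to \<open>a\<close>; \<open>t = - a / c\<close> is small enough.\<close>
  have "(- a / c) * a + (- a / c)\<^sup>2 * b = (a\<^sup>2 / c\<^sup>2) * (b - c)"
    using c by (simp add: power2_eq_square field_simps)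
  moreover have "(a\<^sup>2 / c\<^sup>2) * (b - c) < 0"
    using c \<open>a \<noteq> 0\<close> by (intro mult_pos_neg) auto
  ultimately show False using assms[of "- a / c"] by linarith
qed

text \<open>
  The solution of \<open>R x = \<phi>\<close> is the minimiser of the energy \<open>\<langle>R x, x\<rangle> - 2 \<phi>(x)\<close>. With \<open>R\<close> the
  identity this is the Riesz representation theorem, which gives adjoints; for the control
  weight \<open>R\<close> it gives the inverse \<open>R\<^sup>-\<^sup>1\<close>.
\<close>

lemma coercive_selfadjoint_represents:
  fixes R :: "'a::{real_inner,banach} \<Rightarrow>\<^sub>L 'a" and \<phi> :: "'a \<Rightarrow> real"
  assumes R: "selfadjoint R" and \<epsilon>: "\<epsilon> > 0" "\<And>x. \<epsilon> * (norm x)\<^sup>2 \<le> R x \<bullet> x"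
    and \<phi>: "bounded_linear \<phi>"
  obtains x where "\<And>y. R x \<bullet> y = \<phi> y"
proof -
  interpret \<phi>: bounded_linear \<phi> by fact
  define J where "J x = R x \<bullet> x - 2 * \<phi> x" for x
  have sym: "R x \<bullet> y = R y \<bullet> x" for x y
    using R by (simp add: selfadjoint_def inner_commute)
  have J_line: "J (x + t *\<^sub>R y) = J x + t * (2 * (R x \<bullet> y - \<phi> y)) + t\<^sup>2 * (R y \<bullet> y)" for x y t
    using sym[of x y]
    by (simp add: J_def \<phi>.add \<phi>.scaleR blinfun.add_right blinfun.scaleR_right
        inner_add_left inner_add_right power2_eq_square algebra_simps)
  obtain K where K: "\<And>x. \<bar>\<phi> x\<bar> \<le> norm x * K" "K \<ge> 0"
    using \<phi>.nonneg_bounded by auto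
  have J_below: "- (K\<^sup>2 / \<epsilon>) \<le> J x" for x
  proof -
    \<comment> \<open>Completing the square bounds the energy from below.\<close>
    have "0 \<le> (\<epsilon> * norm x - K)\<^sup>2 / \<epsilon>" using \<epsilon> by simp
    also have "\<dots> = \<epsilon> * (norm x)\<^sup>2 - 2 * (norm x * K) + K\<^sup>2 / \<epsilon>"
      using \<epsilon> by (simp add: power2_eq_square field_simps)
    also have "\<dots> \<le> J x + K\<^sup>2 / \<epsilon>"
      using \<epsilon>(2)[of x] K(1)[of x] by (simp add: J_def abs_le_iff)
    finally show ?thesis by simp
  qed
  define m where "m = (INF x. J x)"
  have bdd: "bdd_below (range J)"
    using J_below by (intro bdd_belowI2)
  have m_le: "m \<le> J x" for x
    unfolding m_def by (rule cINF_lower[OF bdd]) simp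
  have "\<exists>x. J x < m + 1 / real (Suc n)" for n
    using cINF_less_iff[OF _ bdd, of "m + 1 / real (Suc n)"] by (auto simp: m_def)
  then obtain X where X: "\<And>n. J (X n) < m + 1 / real (Suc n)" by metis
  \<comment> \<open>The parallelogram identity for the energy makes a minimising sequence a Cauchy sequence.\<close>
  have par: "\<epsilon> * (norm (x - y))\<^sup>2 \<le> 2 * (J x - m) + 2 * (J y - m)" for x y
  proof -
    define w where "w = (1/2) *\<^sub>R (x + y)"
    have "2 * J x + 2 * J y - 4 * J w = R (x - y) \<bullet> (x - y)"
      using sym[of x y]
      by (simp add: w_def J_def \<phi>.add \<phi>.scaleR blinfun.add_right blinfun.diff_right blinfun.scaleR_right
          inner_add_left inner_add_right inner_diff_left inner_diff_right algebra_simps)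
    moreover have "\<epsilon> * (norm (x - y))\<^sup>2 \<le> R (x - y) \<bullet> (x - y)" by (rule \<epsilon>(2))
    ultimately have "\<epsilon> * (norm (x - y))\<^sup>2 \<le> 2 * J x + 2 * J y - 4 * J w" by (simp only:)
    also have "\<dots> \<le> 2 * (J x - m) + 2 * (J y - m)" using m_le[of w] by simp
    finally show ?thesis .
  qed
  have "Cauchy X"
  proof (rule metric_CauchyI)
    fix e :: real assume e: "e > 0"
    obtain N where N: "4 / (\<epsilon> * e\<^sup>2) < real N" using reals_Archimedean2 by blast
    have "dist (X i) (X j) < e" if "i \<ge> N" "j \<ge> N" for i j
    proof -
      have pos: "\<epsilon> * e\<^sup>2 > 0" using e \<epsilon> by simp
      have N0: "0 < 4 / (\<epsilon> * e\<^sup>2)" using pos by simp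
      then have N1: "real N > 0" using N by linarith
      have "1 / real (Suc i) < 1 / real N" "1 / real (Suc j) < 1 / real N"
        using that N1 by (auto simp: field_simps)
      then have "J (X i) - m < 1 / real N" "J (X j) - m < 1 / real N"
        using X[of i] X[of j] by linarith+
      then have "2 * (J (X i) - m) + 2 * (J (X j) - m) < 4 / real N" by simp
      with par[of "X i" "X j"] have "\<epsilon> * (norm (X i - X j))\<^sup>2 < 4 / real N"
        by (rule le_less_trans)
      also have "\<dots> < \<epsilon> * e\<^sup>2"
        using N N1 pos by (simp add: field_simps)
      finally have "(norm (X i - X j))\<^sup>2 < e\<^sup>2" using \<epsilon>(1) by simp
      then show ?thesis using e by (simp add: dist_norm power_less_imp_less_base)
    qed
    then show "\<exists>M. \<forall>i\<ge>M. \<forall>j\<ge>M. dist (X i) (X j) < e" by blast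
  qed
  then obtain x where x: "X \<longlonglongrightarrow> x" using Cauchy_convergent convergent_def by blast
  have "(\<lambda>n. J (X n)) \<longlonglongrightarrow> J x"
    unfolding J_def by (intro tendsto_intros x \<phi>.tendsto)
  moreover have "(\<lambda>n. m + 1 / real (Suc n)) \<longlonglongrightarrow> m + 0"
    by (intro tendsto_intros LIMSEQ_Suc lim_1_over_n)
  ultimately have "J x \<le> m + 0"
    by (rule LIMSEQ_le) (use X in \<open>auto intro!: exI[of _ 0] less_imp_le\<close>)
  then have min: "J x \<le> J y" for y using m_le[of y] by simp
  have "R x \<bullet> y = \<phi> y" for y
  proof -
    have "2 * (R x \<bullet> y - \<phi> y) = 0"
    proof (rule quadratic_perturbation_zero)
      fix t :: real
      show "0 \<le> t * (2 * (R x \<bullet> y - \<phi> y)) + t\<^sup>2 * (R y \<bullet> y)"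
        using min[of "x + t *\<^sub>R y"] by (simp add: J_line)
    qed
    then show ?thesis by simp
  qed
  then show thesis by (rule that)
qed

lemma adjoint_exists:
  fixes L :: "'a::{real_inner,banach} \<Rightarrow>\<^sub>L 'b::real_inner"
  shows "\<exists>g. \<forall>x y. L x \<bullet> y = x \<bullet> g y"
proof -
  have "\<exists>w. \<forall>x. L x \<bullet> y = x \<bullet> w" for y
  proof -
    have *: "selfadjoint (id_blinfun :: 'a \<Rightarrow>\<^sub>L 'a)" by (simp add: selfadjoint_def)
    have bl: "bounded_linear (\<lambda>x. L x \<bullet> y)"
      by (intro bounded_linear_compose[OF bounded_linear_inner_left] blinfun.bounded_linear_right)
    obtain w where "\<And>x. id_blinfun w \<bullet> x = L x \<bullet> y"
      by (rule coercive_selfadjoint_represents[OF * _ _ bl, of 1]) (auto simp: power2_norm_eq_inner)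
    then show ?thesis by (metis id_blinfun.rep_eq inner_commute)
  qed
  then show ?thesis by metis
qed

lemma inner_adjoint_blinfun:
  fixes L :: "'a::{real_inner,banach} \<Rightarrow>\<^sub>L 'b::real_inner"
  shows "x \<bullet> adjoint L y = L x \<bullet> y" "adjoint L y \<bullet> x = y \<bullet> L x"
proof -
  have "\<forall>x y. L x \<bullet> y = x \<bullet> adjoint L y"
    unfolding adjoint_def by (rule someI_ex[OF adjoint_exists])
  then show "x \<bullet> adjoint L y = L x \<bullet> y" by metis
  then show "adjoint L y \<bullet> x = y \<bullet> L x" by (simp add: inner_commute)
qed

lemma norm_adjoint_blinfun_le:
  fixes L :: "'a::{real_inner,banach} \<Rightarrow>\<^sub>L 'b::real_inner"
  shows "norm (adjoint L y) \<le> norm L * norm y"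
proof -
  have "norm (adjoint L y) * norm (adjoint L y) = L (adjoint L y) \<bullet> y"
    by (simp add: inner_adjoint_blinfun(1)[symmetric] dot_square_norm power2_eq_square)
  also have "\<dots> \<le> norm (L (adjoint L y)) * norm y" by (rule norm_cauchy_schwarz)
  also have "\<dots> \<le> (norm L * norm (adjoint L y)) * norm y"
    by (intro mult_right_mono norm_blinfun) auto
  finally have "norm (adjoint L y) * norm (adjoint L y) \<le> (norm L * norm y) * norm (adjoint L y)"
    by (simp add: mult_ac)
  then show ?thesis
    by (cases "adjoint L y = 0") auto
qed

lemma bounded_linear_adjoint_blinfun:
  fixes L :: "'a::{real_inner,banach} \<Rightarrow>\<^sub>L 'b::real_inner"
  shows "bounded_linear (adjoint L)"
proof (rule bounded_linear_intro[where K="norm L"])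
  show "adjoint L (x + y) = adjoint L x + adjoint L y" for x y
    by (rule vector_eq_rdot[THEN iffD1]) (simp add: inner_adjoint_blinfun inner_add_left)
  show "adjoint L (c *\<^sub>R x) = c *\<^sub>R adjoint L x" for c x
    by (rule vector_eq_rdot[THEN iffD1]) (simp add: inner_adjoint_blinfun)
  show "norm (adjoint L x) \<le> norm x * norm L" for x
    using norm_adjoint_blinfun_le[of L x] by (simp add: mult.commute)
qed

lemma coercive_selfadjoint_inverse:
  fixes R :: "'a::{real_inner,banach} \<Rightarrow>\<^sub>L 'a"
  assumes R: "selfadjoint R" and \<epsilon>: "\<epsilon> > 0" "\<And>x. \<epsilon> * (norm x)\<^sup>2 \<le> R x \<bullet> x"
  shows "R (inv R y) = y" "bounded_linear (inv R)"
proof -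
  have "surj R"
  proof (rule surjI)
    fix y
    obtain x where "\<And>w. R x \<bullet> w = y \<bullet> w"
      by (rule coercive_selfadjoint_represents[OF R \<epsilon> bounded_linear_inner_right[of y]]) auto
    then have "R x = y" using vector_eq_rdot by blast
    then show "R (SOME x. R x = y) = y" by (rule someI)
  qed
  then have inv: "R (inv R y) = y" for y by (rule surj_f_inv_f)
  then show "R (inv R y) = y" .
  have lower: "\<epsilon> * norm x \<le> norm (R x)" for x
  proof (cases "x = 0")
    case False
    have "(\<epsilon> * norm x) * norm x \<le> norm (R x) * norm x"
      using \<epsilon>(2)[of x] norm_cauchy_schwarz[of "R x" x] by (simp add: power2_eq_square mult_ac)
    then show ?thesis using False by simp
  qed simp
  have inj: "x = y" if "R x = R y" for x y
    using lower[of "x - y"] that \<epsilon>(1) by (simp add: blinfun.diff_right mult_le_0_iff)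
  show "bounded_linear (inv R)"
  proof (rule bounded_linear_intro[where K="1 / \<epsilon>"])
    show "inv R (x + y) = inv R x + inv R y" for x y
      by (rule inj) (simp add: inv blinfun.add_right)
    show "inv R (c *\<^sub>R x) = c *\<^sub>R inv R x" for c x
      by (rule inj) (simp add: inv blinfun.scaleR_right)
    show "norm (inv R x) \<le> norm x * (1 / \<epsilon>)" for x
      using lower[of "inv R x"] \<epsilon>(1) by (simp add: inv field_simps)
  qed
qed

text \<open>
  What the rest of the proof uses of \<open>G = B R\<^sup>-\<^sup>1 B\<^sup>*\<close>. The energy \<open>\<langle>G x, x\<rangle>\<close>
  controls \<open>G x\<close> because it is the \<open>R\<close>-energy of the control \<open>R\<^sup>-\<^sup>1 B\<^sup>* x\<close>, and \<open>R\<close> is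
  coercive.
\<close>

lemma BRB_control_operator:
  fixes B :: "'u::{real_inner,banach} \<Rightarrow>\<^sub>L 'h::{real_inner,banach}"
  assumes R: "selfadjoint R" and \<epsilon>: "\<epsilon> > 0" "\<And>x. \<epsilon> * (norm x)\<^sup>2 \<le> R x \<bullet> x"
  shows "bounded_linear (BRB B R)"
    and "BRB B R x \<bullet> y = x \<bullet> BRB B R y"
    and "0 \<le> BRB B R x \<bullet> x"
    and "BRB B R x \<bullet> x = 0 \<Longrightarrow> BRB B R x = 0"
proof -
  note inv = coercive_selfadjoint_inverse[OF R \<epsilon>]
  show "bounded_linear (BRB B R)"
    unfolding BRB_def[abs_def]
    by (intro bounded_linear_compose[OF blinfun.bounded_linear_right]
        bounded_linear_compose[OF inv(2)] bounded_linear_adjoint_blinfun)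
  \<comment> \<open>In terms of the controls \<open>v x = R\<^sup>-\<^sup>1 B\<^sup>* x\<close>, the form of \<open>B R\<^sup>-\<^sup>1 B\<^sup>*\<close> is the form of \<open>R\<close>.\<close>
  define v where "v y = inv R (adjoint B y)" for y
  have form: "BRB B R x \<bullet> y = R (v y) \<bullet> v x" for x y
  proof -
    have "BRB B R x \<bullet> y = v x \<bullet> adjoint B y"
      by (simp add: BRB_def v_def inner_adjoint_blinfun(1))
    then show ?thesis by (simp add: v_def inv(1) inner_commute)
  qed
  have "R (v y) \<bullet> v x = R (v x) \<bullet> v y"
    using R by (simp add: selfadjoint_def inner_commute)
  then show "BRB B R x \<bullet> y = x \<bullet> BRB B R y"
    by (simp only: form inner_commute[of x])
  have "0 \<le> \<epsilon> * (norm (v x))\<^sup>2" using \<epsilon>(1) by simp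
  then show "0 \<le> BRB B R x \<bullet> x" using \<epsilon>(2)[of "v x"] by (simp add: form)
  assume "BRB B R x \<bullet> x = 0"
  then have "v x = 0" using \<epsilon>(2)[of "v x"] \<epsilon>(1) by (simp add: form mult_le_0_iff)
  then show "BRB B R x = 0" by (simp add: BRB_def v_def)
qed

section \<open>Strongly continuous families of operators\<close>

text \<open>
  The sets on which the family is bounded by \<open>n\<close> are closed and cover the space, so by Baire one of
  them contains a ball; translating that ball to the origin bounds the operator norms.
\<close>

lemma uniform_boundedness:
  fixes F :: "'i \<Rightarrow> 'a::banach \<Rightarrow>\<^sub>L 'b::real_normed_vector"
  assumes pointwise: "\<And>x. \<exists>c. \<forall>i\<in>I. norm (F i x) \<le> c"
  obtains C where "C \<ge> 0" "\<And>i. i \<in> I \<Longrightarrow> norm (F i) \<le> C"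
proof -
  define V where "V n = {x. \<forall>i\<in>I. norm (F i x) \<le> real n}" for n :: nat
  have closed: "closed (V n)" for n
  proof -
    have "V n = (\<Inter>i\<in>I. {x. norm (F i x) \<le> real n})" by (auto simp: V_def)
    moreover have "closed {x. norm (F i x) \<le> real n}" for i
      by (intro closed_Collect_le continuous_intros)
    ultimately show ?thesis by auto
  qed
  have cover: "\<Union>(range V) = UNIV"
  proof -
    have "\<exists>n. x \<in> V n" for x
    proof -
      obtain c where "\<forall>i\<in>I. norm (F i x) \<le> c" using pointwise by blast
      moreover obtain n where "c \<le> real n" using real_arch_simple by blast
      ultimately show ?thesis by (auto simp: V_def intro: order_trans)
    qed
    then show ?thesis by blast
  qed
  have "\<exists>n. interior (V n) \<noteq> {}"
  proof (rule ccontr)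
    assume no_interior: "\<nexists>n. interior (V n) \<noteq> {}"
    have "Met_TC.mcomplete TYPE('a)"
      by (simp add: complete_UNIV)
    then have "euclidean interior_of \<Union>(range V) = {}"
      using Met_TC.metric_Baire_category_alt[of "range V"] closed no_interior
      by (auto simp: interior_of_def interior_def)
    then show False by (simp add: cover)
  qed
  then obtain n x r where r: "r > 0" "cball x r \<subseteq> V n"
    by (metis ex_in_conv mem_interior_cball)
  show thesis
  proof
    show "0 \<le> 2 * real n / r" using r by simp
    fix i assume i: "i \<in> I"
    show "norm (F i) \<le> 2 * real n / r"
    proof (rule norm_blinfun_bound)
      show "0 \<le> 2 * real n / r" using r by simp
      fix y
      show "norm (F i y) \<le> 2 * real n / r * norm y"
      proof (cases "y = 0")
        case False
        \<comment> \<open>Both \<open>x\<close> and \<open>x + w\<close> lie in the ball, so \<open>F i w\<close> is a difference of two bounded values.\<close>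
        define w where "w = (r / norm y) *\<^sub>R y"
        have "norm w = r" using False r by (simp add: w_def)
        then have "x + w \<in> V n" "x \<in> V n"
          using r by (auto simp: dist_norm intro!: subsetD[OF r(2)])
        then have "norm (F i (x + w)) \<le> real n" "norm (F i x) \<le> real n"
          using i by (auto simp: V_def)
        then have "norm (F i w) \<le> 2 * real n"
          using norm_triangle_ineq4[of "F i (x + w)" "F i x"] by (simp add: blinfun.add_right)
        moreover have "norm (F i w) = r / norm y * norm (F i y)"
          using r by (simp add: w_def blinfun.scaleR_right)
        ultimately show ?thesis using False r by (simp add: field_simps)
      qed simp
    qed
  qed
qed

lemma strongly_continuous_bounded:
  fixes F :: "'t::topological_space \<Rightarrow> 'a::banach \<Rightarrow>\<^sub>L 'b::real_normed_vector"
  assumes "compact I" "\<And>x. continuous_on I (\<lambda>t. F t x)"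
  obtains C where "C \<ge> 0" "\<And>t. t \<in> I \<Longrightarrow> norm (F t) \<le> C"
proof -
  have "\<exists>c. \<forall>t\<in>I. norm (F t x) \<le> c" for x
  proof -
    have "bounded ((\<lambda>t. F t x) ` I)"
      by (intro compact_imp_bounded compact_continuous_image assms)
    then show ?thesis by (auto simp: bounded_iff)
  qed
  then obtain C where "C \<ge> 0" "\<And>t. t \<in> I \<Longrightarrow> norm (F t) \<le> C"
    using uniform_boundedness[of I F] by metis
  then show thesis by (rule that)
qed

text \<open>
  Strong continuity gives joint continuity of \<open>(t, x) \<mapsto> F t x\<close>, because the operator norms are
  uniformly bounded on compact sets of times. This lets \<open>P(u) z(u)\<close>, \<open>E(v - u) f(u)\<close> and the like be
  treated as continuous functions.
\<close>

lemma continuous_on_strong_apply: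
  fixes F :: "'t::topological_space \<Rightarrow> 'a::banach \<Rightarrow>\<^sub>L 'b::real_normed_vector"
    and f :: "'s::topological_space \<Rightarrow> 'a"
  assumes F: "compact I" "\<And>x. continuous_on I (\<lambda>t. F t x)"
    and g: "continuous_on X g" "\<And>x. x \<in> X \<Longrightarrow> g x \<in> I" and f: "continuous_on X f"
  shows "continuous_on X (\<lambda>x. F (g x) (f x))"
proof -
  obtain C where C: "C \<ge> 0" "\<And>t. t \<in> I \<Longrightarrow> norm (F t) \<le> C"
    by (rule strongly_continuous_bounded[OF F]) blast
  show ?thesis
    unfolding continuous_on_def
  proof
    fix x assume x: "x \<in> X"
    have "((\<lambda>x'. F (g x') (f x' - f x)) \<longlongrightarrow> 0) (at x within X)"
    proof (rule Lim_null_comparison)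
      show "\<forall>\<^sub>F x' in at x within X. norm (F (g x') (f x' - f x)) \<le> C * norm (f x' - f x)"
        unfolding eventually_at_filter
      proof (rule always_eventually, intro allI impI)
        fix x' assume "x' \<in> X"
        then show "norm (F (g x') (f x' - f x)) \<le> C * norm (f x' - f x)"
          using norm_blinfun[of "F (g x')" "f x' - f x"] C(2)[OF g(2)]
          by (meson mult_right_mono norm_ge_zero order_trans)
      qed
      have "((\<lambda>x'. f x' - f x) \<longlongrightarrow> 0) (at x within X)"
        using f x by (simp add: continuous_on_def LIM_zero_iff)
      then show "((\<lambda>x'. C * norm (f x' - f x)) \<longlongrightarrow> 0) (at x within X)"
        by (intro tendsto_mult_right_zero tendsto_norm_zero)
    qed
    moreover have "((\<lambda>x'. F (g x') (f x)) \<longlongrightarrow> F (g x) (f x)) (at x within X)"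
    proof -
      have "continuous_on X (\<lambda>x'. F (g x') (f x))"
        by (rule continuous_on_compose2[OF F(2) g(1)]) (use g(2) in auto)
      then show ?thesis using x by (simp add: continuous_on_def)
    qed
    ultimately have "((\<lambda>x'. F (g x') (f x' - f x) + F (g x') (f x)) \<longlongrightarrow> 0 + F (g x) (f x))
        (at x within X)"
      by (rule tendsto_add)
    then show "((\<lambda>x'. F (g x') (f x')) \<longlongrightarrow> F (g x) (f x)) (at x within X)"
      by (simp add: blinfun.diff_right)
  qed
qed

section \<open>Integrals of weakly continuous functions\<close>

lemma norm_le_iff_inner_dense:
  fixes x :: "'a::real_inner"
  assumes D: "\<And>X. open X \<Longrightarrow> X \<noteq> {} \<Longrightarrow> \<exists>d\<in>D. d \<in> X" and e: "e \<ge> 0"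
  shows "norm x \<le> e \<longleftrightarrow> (\<forall>d\<in>D. x \<bullet> d \<le> e * norm d)"
proof
  assume "norm x \<le> e"
  then show "\<forall>d\<in>D. x \<bullet> d \<le> e * norm d"
    by (meson mult_right_mono norm_cauchy_schwarz norm_ge_zero order_trans)
next
  assume le: "\<forall>d\<in>D. x \<bullet> d \<le> e * norm d"
  have "open {d. e * norm d < x \<bullet> d}"
    by (intro open_Collect_less continuous_intros)
  then have "{d. e * norm d < x \<bullet> d} = {}"
    using D[of "{d. e * norm d < x \<bullet> d}"] le by fastforce
  then have "\<not> e * norm x < x \<bullet> x" by blast
  then have "norm x * norm x \<le> e * norm x" by (simp add: dot_square_norm power2_eq_square)
  then show "norm x \<le> e" using e by (cases "x = 0") auto
qed

text \<open>
  Pettis' theorem: preimages of closed balls are countable intersections of half-space conditions,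
  and in a separable space every open set is a countable union of closed balls.
\<close>

lemma weakly_measurable_imp_measurable:
  fixes f :: "'m \<Rightarrow> 'a::{real_inner,second_countable_topology}"
  assumes weak: "\<And>y. (\<lambda>u. f u \<bullet> y) \<in> borel_measurable M"
  shows "f \<in> borel_measurable M"
proof (rule borel_measurableI)
  fix S :: "'a set" assume S: "open S"
  obtain D :: "'a set" where D: "countable D" "\<And>X. open X \<Longrightarrow> X \<noteq> {} \<Longrightarrow> \<exists>d\<in>D. d \<in> X"
    by (rule countable_dense_setE) blast
  have ball: "{u \<in> space M. norm (f u - c) \<le> e} \<in> sets M" if "e \<ge> 0" for c e
  proof -
    have "{u \<in> space M. norm (f u - c) \<le> e}
        = {u \<in> space M. \<forall>d\<in>D. f u \<bullet> d - c \<bullet> d \<le> e * norm d}"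
      using norm_le_iff_inner_dense[OF D(2) that] by (simp add: inner_diff_left)
    also have "\<dots> \<in> sets M"
      by (intro sets.sets_Collect_countable_All' D(1) borel_measurable_le
          borel_measurable_diff weak borel_measurable_const)
    finally show ?thesis .
  qed
  define N where "N = {(d, n::nat). d \<in> D \<and> cball d (1 / Suc n) \<subseteq> S}"
  have "countable N"
    by (rule countable_subset[of _ "D \<times> UNIV"]) (auto simp: N_def D(1))
  have "S \<subseteq> (\<Union>(d, n)\<in>N. cball d (1 / Suc n))"
  proof
    fix x assume "x \<in> S"
    then obtain r where r: "r > 0" "ball x r \<subseteq> S" using S open_contains_ball by blast
    obtain n where n: "1 / real (Suc n) < r / 2" using r(1) nat_approx_posE[of "r / 2"] by auto
    obtain d where d: "d \<in> D" "d \<in> ball x (1 / Suc n)"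
      using D(2)[of "ball x (1 / Suc n)"] by auto
    have "cball d (1 / Suc n) \<subseteq> ball x r"
    proof
      fix y assume "y \<in> cball d (1 / Suc n)"
      then show "y \<in> ball x r"
        using d(2) n dist_triangle[of x y d] by (simp add: dist_commute)
    qed
    then have "(d, n) \<in> N" using d(1) r(2) by (auto simp: N_def)
    moreover have "x \<in> cball d (1 / Suc n)" using d(2) by (simp add: dist_commute)
    ultimately show "x \<in> (\<Union>(d, n)\<in>N. cball d (1 / Suc n))" by blast
  qed
  then have S_eq: "S = (\<Union>(d, n)\<in>N. cball d (1 / Suc n))" by (auto simp: N_def)
  have "f -` S \<inter> space M = (\<Union>(d, n)\<in>N. {u \<in> space M. norm (f u - d) \<le> 1 / Suc n})"
    by (subst S_eq) (force simp: dist_norm norm_minus_commute)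
  also have "\<dots> \<in> sets M"
    using \<open>countable N\<close> ball by (intro sets.countable_UN') auto
  finally show "f -` S \<inter> space M \<in> sets M" .
qed

text \<open>
  For a strongly continuous \<open>E\<close> and a continuous \<open>g\<close>, the function \<open>u \<mapsto> E(u - t)\<^sup>* g(u)\<close> is at once seen to be weakly continuous,
  since the adjoint can be moved onto the test vector. That is enough for Bochner integrability:
  measurability is Pettis' theorem and boundedness is the uniform boundedness principle for the
  functionals \<open>\<langle>f(u), \<cdot>\<rangle>\<close>.
\<close>

lemma set_integrable_weakly_continuous:
  fixes f :: "real \<Rightarrow> 'a::{real_inner,banach,second_countable_topology}"
  assumes weak: "\<And>y. continuous_on {a..b} (\<lambda>u. f u \<bullet> y)"
  shows "set_integrable lborel {a..b} f"
proof -
  have "\<And>y. continuous_on {a..b} (\<lambda>u. blinfun_inner_right (f u) y)" using weak by simp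
  then obtain C where C: "C \<ge> 0" "\<And>u. u \<in> {a..b} \<Longrightarrow> norm (blinfun_inner_right (f u)) \<le> C"
    using strongly_continuous_bounded[of "{a..b}" "\<lambda>u. blinfun_inner_right (f u)"] by auto
  have bound: "norm (f u) \<le> C" if "u \<in> {a..b}" for u
  proof -
    have "norm (f u) * norm (f u) \<le> norm (blinfun_inner_right (f u)) * norm (f u)"
      using norm_blinfun[of "blinfun_inner_right (f u)" "f u"]
      by (simp add: dot_square_norm power2_eq_square)
    also have "\<dots> \<le> C * norm (f u)" using C(2)[OF that] by (intro mult_right_mono) auto
    finally show ?thesis using C(1) by (cases "f u = 0") auto
  qed
  define g where "g u = indicator {a..b} u *\<^sub>R f u" for u
  have "g \<in> borel_measurable borel"
  proof (rule weakly_measurable_imp_measurable)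
    fix y
    have "(\<lambda>u. indicator {a..b} u *\<^sub>R (f u \<bullet> y)) \<in> borel_measurable borel"
      by (intro borel_measurable_continuous_on_indicator weak) auto
    then show "(\<lambda>u. g u \<bullet> y) \<in> borel_measurable borel" by (simp add: g_def)
  qed
  then have "integrable lborel g"
    by (intro integrableI_bounded_set[of "{a..b}" _ _ C])
       (auto simp: g_def bound emeasure_lborel_Icc_eq)
  then show ?thesis by (simp add: set_integrable_def g_def[abs_def])
qed

lemma set_integral_inner_left:
  fixes f :: "'m \<Rightarrow> 'a::{real_inner,banach,second_countable_topology}"
  assumes "set_integrable M X f"
  shows "(LINT u:X|M. f u) \<bullet> y = (LINT u:X|M. f u \<bullet> y)"
  using integral_inner_left[of y M "\<lambda>u. indicator X u *\<^sub>R f u"] assms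
  by (simp add: set_integrable_def set_lebesgue_integral_def)

text \<open>
  If \<open>f\<close> is not integrable, its integral is 0 by convention, and the bound holds since \<open>h\<close> is nonnegative.
\<close>

lemma norm_set_integral_le:
  fixes f :: "'m \<Rightarrow> 'a::{banach,second_countable_topology}"
  assumes h: "set_integrable M X h" and le: "\<And>u. u \<in> X \<Longrightarrow> norm (f u) \<le> h u"
  shows "norm (LINT u:X|M. f u) \<le> (LINT u:X|M. h u)"
proof -
  have nonneg: "0 \<le> h u" if "u \<in> X" for u using le[OF that] norm_ge_zero order_trans by blast
  show ?thesis
  proof (cases "integrable M (\<lambda>u. indicator X u *\<^sub>R f u)")
    case True
    have "norm (LINT u:X|M. f u) \<le> (LINT u|M. norm (indicator X u *\<^sub>R f u))"
      unfolding set_lebesgue_integral_def by (rule integral_norm_bound)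
    also have "\<dots> \<le> (LINT u:X|M. h u)"
      unfolding set_lebesgue_integral_def
      by (intro integral_mono integrable_norm True h[unfolded set_integrable_def])
         (auto simp: le split: split_indicator)
    finally show ?thesis .
  next
    case False
    then have "(LINT u:X|M. f u) = 0"
      unfolding set_lebesgue_integral_def by (rule not_integrable_integral_eq)
    moreover have "0 \<le> (LINT u:X|M. h u)"
      unfolding set_lebesgue_integral_def
      by (rule Bochner_Integration.integral_nonneg) (auto simp: nonneg split: split_indicator)
    ultimately show ?thesis by simp
  qed
qed

section \<open>Gronwall estimates without measurability\<close>

text \<open>
  The Gronwall lemmas below are applied to \<open>t \<mapsto> norm (P t - P' t)\<close> for strongly continuous families,
  whose measurability is not evident. They are therefore stated through continuous
  majorants \<open>h\<close> of \<open>\<Phi>\<close>: with an exponential weight \<open>w\<close> that grows twice as fast as the integral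
  inequality demands, one application halves the constant in \<open>\<Phi> \<le> a w\<close>, and iteration gives
  \<open>\<Phi> \<le> 0\<close>.
\<close>

lemma nonpos_if_bound_halves:
  fixes \<Phi> w :: "'t \<Rightarrow> real"
  assumes init: "a \<ge> 0" "\<And>t. t \<in> I \<Longrightarrow> \<Phi> t \<le> a * w t"
    and halve: "\<And>a. a \<ge> 0 \<Longrightarrow> (\<And>t. t \<in> I \<Longrightarrow> \<Phi> t \<le> a * w t) \<Longrightarrow> (\<And>t. t \<in> I \<Longrightarrow> \<Phi> t \<le> a / 2 * w t)"
    and t: "t \<in> I"
  shows "\<Phi> t \<le> 0"
proof -
  have "\<forall>t\<in>I. \<Phi> t \<le> a / 2 ^ n * w t" for n :: nat
  proof (induction n)
    case (Suc n)
    then show ?case using halve[of "a / 2 ^ n"] init(1) by (simp add: mult.commute)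
  qed (simp add: init)
  then have "\<Phi> t \<le> a * w t * (1 / 2) ^ n" for n
    using t by (simp add: power_one_over field_simps)
  moreover have "(\<lambda>n. a * w t * (1 / 2) ^ n) \<longlonglongrightarrow> a * w t * 0"
    by (intro tendsto_intros LIMSEQ_power_zero) auto
  ultimately show ?thesis
    by (intro LIMSEQ_le_const[where X="\<lambda>n. a * w t * (1 / 2) ^ n"]) auto
qed

lemma set_integral_exp:
  fixes a b c k :: real
  assumes "a \<le> b" "c \<noteq> 0"
  shows "(LBINT u:{a..b}. k * exp (c * u)) = k / c * (exp (c * b) - exp (c * a))"
proof -
  have "(LBINT u. indicator {a..b} u *\<^sub>R (k * exp (c * u)))
      = k / c * exp (c * b) - k / c * exp (c * a)"
    using assms
    by (intro integral_FTC_atLeastAtMost)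
       (auto intro!: derivative_eq_intros continuous_intros
             simp flip: has_real_derivative_iff_has_vector_derivative)
  then show ?thesis unfolding set_lebesgue_integral_def by (simp only: right_diff_distrib)
qed

lemma gronwall_forward:
  fixes \<Phi> :: "real \<Rightarrow> real"
  assumes bound: "\<And>t. t \<in> {0..T} \<Longrightarrow> \<Phi> t \<le> K" and C: "C > 0"
    and int: "\<And>h t. continuous_on {0..T} h \<Longrightarrow> (\<And>u. u \<in> {0..T} \<Longrightarrow> \<Phi> u \<le> h u) \<Longrightarrow> t \<in> {0..T} \<Longrightarrow>
      \<Phi> t \<le> (LBINT u:{0..t}. C * h u)"
    and t: "t \<in> {0..T}"
  shows "\<Phi> t \<le> 0"
proof (rule nonpos_if_bound_halves[where I="{0..T}" and w="\<lambda>t. exp (2 * C * t)", OF _ _ _ t])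
  show "0 \<le> \<bar>K\<bar>" by simp
  fix t assume t: "t \<in> {0..T}"
  have "\<Phi> t \<le> \<bar>K\<bar> * 1" using bound[OF t] by simp
  also have "\<dots> \<le> \<bar>K\<bar> * exp (2 * C * t)" using t C by (intro mult_left_mono) auto
  finally show "\<Phi> t \<le> \<bar>K\<bar> * exp (2 * C * t)" .
next
  fix a :: real and t assume "a \<ge> 0" and t: "t \<in> {0..T}"
    and a: "\<And>t. t \<in> {0..T} \<Longrightarrow> \<Phi> t \<le> a * exp (2 * C * t)"
  have "\<Phi> t \<le> (LBINT u:{0..t}. C * (a * exp (2 * C * u)))"
    by (rule int[OF _ a t]) (intro continuous_intros)
  also have "\<dots> = a / 2 * exp (2 * C * t) - a / 2"
    using set_integral_exp[of 0 t "2 * C" "C * a"] t C by (simp add: mult.assoc right_diff_distrib)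
  also have "\<dots> \<le> a / 2 * exp (2 * C * t)" using \<open>a \<ge> 0\<close> by simp
  finally show "\<Phi> t \<le> a / 2 * exp (2 * C * t)" .
qed

lemma gronwall_backward:
  fixes \<Phi> :: "real \<Rightarrow> real"
  assumes bound: "\<And>t. t \<in> {0..T} \<Longrightarrow> \<Phi> t \<le> K" and C: "C > 0"
    and int: "\<And>h t. continuous_on {0..T} h \<Longrightarrow> (\<And>u. u \<in> {0..T} \<Longrightarrow> \<Phi> u \<le> h u) \<Longrightarrow> t \<in> {0..T} \<Longrightarrow>
      \<Phi> t \<le> (LBINT u:{t..T}. C * h u)"
    and t: "t \<in> {0..T}"
  shows "\<Phi> t \<le> 0"
proof (rule nonpos_if_bound_halves[where I="{0..T}" and w="\<lambda>t. exp (- (2 * C) * t)", OF _ _ _ t])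
  show "0 \<le> \<bar>K\<bar> * exp (2 * C * T)" by simp
  fix t assume t: "t \<in> {0..T}"
  have "\<Phi> t \<le> \<bar>K\<bar> * 1" using bound[OF t] by simp
  also have "\<dots> \<le> \<bar>K\<bar> * exp (2 * C * T + - (2 * C) * t)"
    using t C by (intro mult_left_mono) auto
  also have "\<dots> = \<bar>K\<bar> * exp (2 * C * T) * exp (- (2 * C) * t)" by (simp only: exp_add mult.assoc)
  finally show "\<Phi> t \<le> \<bar>K\<bar> * exp (2 * C * T) * exp (- (2 * C) * t)" .
next
  fix a :: real and t assume "a \<ge> 0" and t: "t \<in> {0..T}"
    and a: "\<And>t. t \<in> {0..T} \<Longrightarrow> \<Phi> t \<le> a * exp (- (2 * C) * t)"
  have "\<Phi> t \<le> (LBINT u:{t..T}. C * (a * exp (- (2 * C) * u)))"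
    by (rule int[OF _ a t]) (intro continuous_intros)
  also have "\<dots> = (C * a) / (- (2 * C)) * (exp (- (2 * C) * T) - exp (- (2 * C) * t))"
    using set_integral_exp[of t T "- (2 * C)" "C * a"] t C by (simp add: mult.assoc)
  also have "\<dots> = a / 2 * exp (- (2 * C) * t) - a / 2 * exp (- (2 * C) * T)"
    using C by (simp add: field_simps)
  also have "\<dots> \<le> a / 2 * exp (- (2 * C) * t)" using \<open>a \<ge> 0\<close> by simp
  finally show "\<Phi> t \<le> a / 2 * exp (- (2 * C) * t)" .
qed

section \<open>Convolution with a strongly continuous family and with its adjoint\<close>

lemma set_integral_triangle_swap:
  fixes k :: "real \<Rightarrow> real \<Rightarrow> real"
  assumes k: "continuous_on {(u, v). 0 \<le> u \<and> u \<le> v \<and> v \<le> T} (\<lambda>(u, v). k u v)"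
  shows "(LBINT u:{0..T}. LBINT v:{u..T}. k u v) = (LBINT v:{0..T}. LBINT u:{0..v}. k u v)"
proof -
  define \<Delta> where "\<Delta> = {(u, v). 0 \<le> u \<and> u \<le> v \<and> v \<le> T}"
  define g where "g u v = indicator \<Delta> (u, v) *\<^sub>R k u v" for u v
  have "compact \<Delta>"
  proof (rule compact_Int_closed[of "{0..T} \<times> {0..T}" "{p. fst p \<le> snd p}", THEN back_subst[of compact]])
    show "compact ({0..T} \<times> {0..T})" by (intro compact_Times compact_Icc)
    show "closed {p::real \<times> real. fst p \<le> snd p}"
      by (intro closed_Collect_le continuous_intros)
    show "{0..T} \<times> {0..T} \<inter> {p. fst p \<le> snd p} = \<Delta>" by (auto simp: \<Delta>_def)
  qed
  then have "integrable lborel (\<lambda>p. indicator \<Delta> p *\<^sub>R (case p of (u, v) \<Rightarrow> k u v))"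
    using k by (intro borel_integrable_compact) (simp_all add: \<Delta>_def)
  then have "integrable (lborel \<Otimes>\<^sub>M lborel) (\<lambda>(u, v). g u v)"
    by (simp add: lborel_prod g_def case_prod_unfold)
  then have "(LBINT v. LBINT u. g u v) = (LBINT u. LBINT v. g u v)"
    by (rule lborel_pair.Fubini_integral)
  moreover have "(LBINT u. g u v) = indicator {0..T} v *\<^sub>R (LBINT u:{0..v}. k u v)" for v
  proof -
    have "g u v = indicator {0..T} v * (indicator {0..v} u *\<^sub>R k u v)" for u
      by (auto simp: g_def \<Delta>_def split: split_indicator)
    then show ?thesis by (simp add: set_lebesgue_integral_def)
  qed
  moreover have "(LBINT v. g u v) = indicator {0..T} u *\<^sub>R (LBINT v:{u..T}. k u v)" for u
  proof -
    have "g u v = indicator {0..T} u * (indicator {u..T} v *\<^sub>R k u v)" for v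
      by (auto simp: g_def \<Delta>_def split: split_indicator)
    then show ?thesis by (simp add: set_lebesgue_integral_def)
  qed
  ultimately show ?thesis by (simp add: set_lebesgue_integral_def)
qed

lemma continuous_on_convolution:
  fixes E :: "real \<Rightarrow> 'a::banach \<Rightarrow>\<^sub>L 'b::real_normed_vector"
  assumes E: "\<And>x. continuous_on {0..T} (\<lambda>t. E t x)"
    and f: "continuous_on {0..t} f" and t: "t \<le> T"
  shows "continuous_on {0..t} (\<lambda>u. E (t - u) (f u))"
  by (rule continuous_on_strong_apply[OF compact_Icc E _ _ f]) (use t in \<open>auto intro!: continuous_intros\<close>)

lemma set_integrable_convolution:
  fixes E :: "real \<Rightarrow> 'a::banach \<Rightarrow>\<^sub>L 'b::{banach,second_countable_topology}"
  assumes "\<And>x. continuous_on {0..T} (\<lambda>t. E t x)" "continuous_on {0..t} f" "t \<le> T"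
  shows "set_integrable lborel {0..t} (\<lambda>u. E (t - u) (f u))"
  by (intro borel_integrable_atLeastAtMost' continuous_on_convolution[OF assms])

lemma set_integrable_adjoint_convolution:
  fixes E :: "real \<Rightarrow> 'a::{real_inner,banach,second_countable_topology} \<Rightarrow>\<^sub>L 'b::real_inner"
  assumes E: "\<And>x. continuous_on {0..T} (\<lambda>t. E t x)"
    and g: "continuous_on {t..T} g" and t: "0 \<le> t"
  shows "set_integrable lborel {t..T} (\<lambda>u. adjoint (E (u - t)) (g u))"
proof (rule set_integrable_weakly_continuous)
  fix y
  have "continuous_on {t..T} (\<lambda>u. E (u - t) y)"
    by (rule continuous_on_strong_apply[OF compact_Icc E]) (use t in \<open>auto intro!: continuous_intros\<close>)
  then show "continuous_on {t..T} (\<lambda>u. adjoint (E (u - t)) (g u) \<bullet> y)"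
    by (simp add: inner_adjoint_blinfun(2) continuous_on_inner g)
qed

text \<open>
  For smooth data, \<open>z' = A z + f\<close> with \<open>z(0) = 0\<close> and \<open>r' = - A\<^sup>* r - g\<close> with \<open>r(T) = \<rho>\<close>, so that
  \<open>\<langle>r, z\<rangle>' = \<langle>r, f\<rangle> - \<langle>g, z\<rangle>\<close> and integration over \<open>[0,T]\<close> gives the identity. Mild solutions
  need not be differentiable; instead both sides are expanded with the integral equations, and the double
  integrals of \<open>\<langle>g(v), E(v - u) f(u)\<rangle>\<close> over the triangle \<open>u \<le> v\<close> agree by Fubini.
\<close>

lemma mild_duality:
  fixes E :: "real \<Rightarrow> 'h::{real_inner,banach,second_countable_topology} \<Rightarrow>\<^sub>L 'h"
  assumes E: "\<And>x. continuous_on {0..T} (\<lambda>t. E t x)" and T: "0 \<le> T"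
    and f: "continuous_on {0..T} f" and g: "continuous_on {0..T} g" and r: "continuous_on {0..T} r"
    and z_eq: "\<And>t. t \<in> {0..T} \<Longrightarrow> z t = (LBINT u:{0..t}. E (t - u) (f u))"
    and r_eq: "\<And>t. t \<in> {0..T} \<Longrightarrow>
      r t = adjoint (E (T - t)) \<rho> + (LBINT u:{t..T}. adjoint (E (u - t)) (g u))"
  shows "\<rho> \<bullet> z T = (LBINT u:{0..T}. r u \<bullet> f u) - (LBINT u:{0..T}. g u \<bullet> z u)"
proof -
  \<comment> \<open>Up to the boundary term with \<open>\<rho>\<close>, both pairings are integrals of this kernel over \<open>u \<le> v\<close>.\<close>
  define k where "k u v = g v \<bullet> E (v - u) (f u)" for u v
  have r_f: "r u \<bullet> f u - E (T - u) (f u) \<bullet> \<rho> = (LBINT v:{u..T}. k u v)" if u: "u \<in> {0..T}" for u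
  proof -
    have "set_integrable lborel {u..T} (\<lambda>v. adjoint (E (v - u)) (g v))"
      by (rule set_integrable_adjoint_convolution[OF E continuous_on_subset[OF g]]) (use u in auto)
    then have "(LBINT v:{u..T}. adjoint (E (v - u)) (g v)) \<bullet> f u = (LBINT v:{u..T}. k u v)"
      by (simp add: set_integral_inner_left inner_adjoint_blinfun(2) k_def)
    moreover have "adjoint (E (T - u)) \<rho> \<bullet> f u = E (T - u) (f u) \<bullet> \<rho>"
      by (metis inner_adjoint_blinfun(2) inner_commute)
    ultimately show ?thesis by (simp add: r_eq[OF u] inner_add_left)
  qed
  have g_z: "g v \<bullet> z v = (LBINT u:{0..v}. k u v)" if v: "v \<in> {0..T}" for v
  proof -
    have "set_integrable lborel {0..v} (\<lambda>u. E (v - u) (f u))"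
      by (rule set_integrable_convolution[OF E continuous_on_subset[OF f]]) (use v in auto)
    then show ?thesis
      by (simp add: z_eq[OF v] set_integral_inner_left inner_commute[of "g v"] k_def)
  qed
  have cont: "continuous_on {(u, v). 0 \<le> u \<and> u \<le> v \<and> v \<le> T} (\<lambda>(u, v). k u v)"
    unfolding k_def case_prod_unfold
  proof (intro continuous_on_inner continuous_on_strong_apply[OF compact_Icc E])
    show "continuous_on {p. 0 \<le> fst p \<and> fst p \<le> snd p \<and> snd p \<le> T} (\<lambda>p. g (snd p))"
      by (rule continuous_on_compose2[OF g]) (auto intro!: continuous_intros)
    show "continuous_on {p. 0 \<le> fst p \<and> fst p \<le> snd p \<and> snd p \<le> T} (\<lambda>p. f (fst p))"
      by (rule continuous_on_compose2[OF f]) (auto intro!: continuous_intros)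
  qed (auto intro!: continuous_intros)
  have E_f: "set_integrable lborel {0..T} (\<lambda>u. E (T - u) (f u))"
    by (rule set_integrable_convolution[OF E f]) simp
  have "(LBINT u:{0..T}. r u \<bullet> f u) - (LBINT u:{0..T}. E (T - u) (f u) \<bullet> \<rho>)
      = (LBINT u:{0..T}. r u \<bullet> f u - E (T - u) (f u) \<bullet> \<rho>)"
    by (intro set_integral_diff(2)[symmetric] borel_integrable_atLeastAtMost' continuous_intros
        continuous_on_convolution[OF E f] r f) simp
  also have "\<dots> = (LBINT u:{0..T}. LBINT v:{u..T}. k u v)"
    by (rule set_lebesgue_integral_cong) (auto simp: r_f)
  also have "\<dots> = (LBINT v:{0..T}. LBINT u:{0..v}. k u v)"
    by (rule set_integral_triangle_swap[OF cont])
  also have "\<dots> = (LBINT v:{0..T}. g v \<bullet> z v)"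
    by (rule set_lebesgue_integral_cong) (auto simp: g_z)
  also have "(LBINT u:{0..T}. E (T - u) (f u) \<bullet> \<rho>) = \<rho> \<bullet> z T"
    using T by (simp add: z_eq set_integral_inner_left[OF E_f, symmetric] inner_commute[of \<rho>])
  finally show ?thesis by simp
qed

lemma set_integral_nonneg_continuous_eq_0:
  fixes q :: "real \<Rightarrow> real"
  assumes "continuous_on {a..b} q" "a < b" "\<And>u. u \<in> {a..b} \<Longrightarrow> 0 \<le> q u"
    and "(LBINT u:{a..b}. q u) \<le> 0" and u: "u \<in> {a..b}"
  shows "q u = 0"
proof -
  have "integral {a..b} q \<le> 0"
    using set_borel_integral_eq_integral(2)[OF borel_integrable_atLeastAtMost'[OF assms(1)]] assms(4)
    by simp
  moreover have "0 \<le> integral {a..b} q"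
    by (rule integral_nonneg) (auto intro: assms integrable_continuous_real)
  ultimately show ?thesis using integral_eq_0_iff[of a b q] assms by simp
qed

section \<open>Uniqueness for the Riccati equation\<close>

text \<open>
  For \<open>W = P - P'\<close> one has \<open>P G P - P' G P' = P G W + W G P'\<close>, which is linear in \<open>W\<close> with bounded
  coefficients, so \<open>norm W\<close> satisfies a homogeneous Gronwall inequality backward from \<open>T\<close>. The
  terms of the equation that do not involve \<open>P\<close> are collected in \<open>c\<close>.
\<close>

lemma riccati_unique:
  fixes E P P' :: "real \<Rightarrow> 'h::{real_inner,banach,second_countable_topology} \<Rightarrow>\<^sub>L 'h"
  assumes E: "\<And>x. continuous_on {0..T} (\<lambda>t. E t x)" and G: "bounded_linear G"
    and P: "\<And>x. continuous_on {0..T} (\<lambda>t. P t x)" and P': "\<And>x. continuous_on {0..T} (\<lambda>t. P' t x)"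
    and P_eq: "\<And>t x. t \<in> {0..T} \<Longrightarrow>
      P t x = c t x - (LBINT u:{t..T}. adjoint (E (u - t)) (P u (G (P u (E (u - t) x)))))"
    and P'_eq: "\<And>t x. t \<in> {0..T} \<Longrightarrow>
      P' t x = c t x - (LBINT u:{t..T}. adjoint (E (u - t)) (P' u (G (P' u (E (u - t) x)))))"
    and t: "t \<in> {0..T}"
  shows "P t = P' t"
proof -
  interpret G: bounded_linear G by fact
  obtain e where e: "e \<ge> 0" "\<And>t. t \<in> {0..T} \<Longrightarrow> norm (E t) \<le> e"
    by (rule strongly_continuous_bounded[OF compact_Icc E]) blast
  obtain p where p: "p \<ge> 0" "\<And>t. t \<in> {0..T} \<Longrightarrow> norm (P t) \<le> p"
    by (rule strongly_continuous_bounded[OF compact_Icc P]) blast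
  obtain p' where p': "p' \<ge> 0" "\<And>t. t \<in> {0..T} \<Longrightarrow> norm (P' t) \<le> p'"
    by (rule strongly_continuous_bounded[OF compact_Icc P']) blast
  obtain \<kappa> where \<kappa>: "\<And>x. norm (G x) \<le> norm x * \<kappa>" "\<kappa> \<ge> 0"
    using G.nonneg_bounded by blast
  \<comment> \<open>The summand 1 only makes the constant positive.\<close>
  define C where "C = e * ((p + p') * \<kappa>) * e + 1"
  have nonneg: "0 \<le> e * ((p + p') * \<kappa>) * e" using e p p' \<kappa> by simp
  have "norm (P t - P' t) \<le> 0"
  proof (rule gronwall_backward[where \<Phi>="\<lambda>t. norm (P t - P' t)" and C=C and K="p + p'", OF _ _ _ t])
    show "norm (P t - P' t) \<le> p + p'" if "t \<in> {0..T}" for t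
      using norm_triangle_ineq4[of "P t" "P' t"] p(2)[OF that] p'(2)[OF that] by simp
    show "C > 0" using nonneg by (simp add: C_def)
    fix h t assume h: "continuous_on {0..T} h" "\<And>u. u \<in> {0..T} \<Longrightarrow> norm (P u - P' u) \<le> h u"
      and t: "t \<in> {0..T}"
    have h_nonneg: "0 \<le> h u" if "u \<in> {0..T}" for u
      using h(2)[OF that] norm_ge_zero order_trans by blast
    have h_int: "set_integrable lborel {t..T} (\<lambda>u. C * h u)"
      by (intro borel_integrable_atLeastAtMost' continuous_intros continuous_on_subset[OF h(1)])
        (use t in auto)
    show "norm (P t - P' t) \<le> (LBINT u:{t..T}. C * h u)"
    proof (rule norm_blinfun_bound)
      show "0 \<le> (LBINT u:{t..T}. C * h u)"
        unfolding set_lebesgue_integral_def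
        by (rule Bochner_Integration.integral_nonneg)
          (use nonneg h_nonneg t in \<open>auto simp: C_def split: split_indicator\<close>)
      fix x
      define y where "y u = E (u - t) x" for u
      have y: "continuous_on {t..T} y"
        unfolding y_def by (rule continuous_on_strong_apply[OF compact_Icc E])
          (use t in \<open>auto intro!: continuous_intros\<close>)
      have int: "set_integrable lborel {t..T} (\<lambda>u. adjoint (E (u - t)) (F u (G (F u (y u)))))"
        if F: "\<And>x. continuous_on {0..T} (\<lambda>t. F t x)" for F :: "real \<Rightarrow> 'h \<Rightarrow>\<^sub>L 'h"
        by (intro set_integrable_adjoint_convolution[OF E] continuous_on_strong_apply[OF compact_Icc F]
            G.continuous_on y) (use t in auto)
      have "norm ((P t - P' t) x)
          = norm (LBINT u:{t..T}. adjoint (E (u - t)) (P u (G (P u (y u))))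
              - adjoint (E (u - t)) (P' u (G (P' u (y u)))))"
        by (simp add: blinfun.diff_left P_eq[OF t] P'_eq[OF t] set_integral_diff(2) int P P'
            y_def[symmetric] norm_minus_commute)
      also have "\<dots> \<le> (LBINT u:{t..T}. C * h u * norm x)"
      proof (rule norm_set_integral_le)
        show "set_integrable lborel {t..T} (\<lambda>u. C * h u * norm x)" using h_int by simp
        fix u assume u: "u \<in> {t..T}"
        then have u0: "u \<in> {0..T}" "u - t \<in> {0..T}" using t by auto
        have *: "norm ((P u - P' u) w) \<le> h u * norm w" for w
          using norm_blinfun[of "P u - P' u" w] h(2)[OF u0(1)]
          by (meson mult_right_mono norm_ge_zero order_trans)
        have Pn: "norm (P u w) \<le> p * norm w" "norm (P' u w) \<le> p' * norm w" for w
          using norm_blinfun[of "P u" w] norm_blinfun[of "P' u" w] p(2)[OF u0(1)] p'(2)[OF u0(1)]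
          by (meson mult_right_mono norm_ge_zero order_trans)+
        have y_le: "norm (y u) \<le> e * norm x"
          unfolding y_def using norm_blinfun[of "E (u - t)" x] e(2)[OF u0(2)]
          by (meson mult_right_mono norm_ge_zero order_trans)
        have "P u (G (P u (y u))) - P' u (G (P' u (y u)))
            = P u (G ((P u - P' u) (y u))) + (P u - P' u) (G (P' u (y u)))"
          by (simp add: blinfun.diff_left blinfun.diff_right G.diff)
        also have "norm \<dots> \<le> p * (h u * norm (y u) * \<kappa>) + h u * (p' * norm (y u) * \<kappa>)"
        proof (rule norm_triangle_mono)
          have "norm (G ((P u - P' u) (y u))) \<le> h u * norm (y u) * \<kappa>"
            using \<kappa>(1) *[of "y u"] \<kappa>(2) by (meson mult_right_mono order_trans)
          then show "norm (P u (G ((P u - P' u) (y u)))) \<le> p * (h u * norm (y u) * \<kappa>)"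
            using Pn(1) p(1) by (meson mult_left_mono order_trans)
          have "norm (G (P' u (y u))) \<le> p' * norm (y u) * \<kappa>"
            using \<kappa>(1) Pn(2)[of "y u"] \<kappa>(2) by (meson mult_right_mono order_trans)
          then show "norm ((P u - P' u) (G (P' u (y u)))) \<le> h u * (p' * norm (y u) * \<kappa>)"
            using * h_nonneg[OF u0(1)] by (meson mult_left_mono order_trans)
        qed
        also have "\<dots> = (p + p') * \<kappa> * h u * norm (y u)" by (simp add: algebra_simps)
        also have "\<dots> \<le> (p + p') * \<kappa> * h u * (e * norm x)"
          using y_le p(1) p'(1) \<kappa>(2) h_nonneg[OF u0(1)] by (intro mult_left_mono) auto
        finally have diff: "norm (P u (G (P u (y u))) - P' u (G (P' u (y u))))
            \<le> (p + p') * \<kappa> * h u * (e * norm x)" .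
        have "norm (adjoint (E (u - t)) (P u (G (P u (y u)))) - adjoint (E (u - t)) (P' u (G (P' u (y u)))))
            \<le> norm (E (u - t)) * norm (P u (G (P u (y u))) - P' u (G (P' u (y u))))"
          using norm_adjoint_blinfun_le[of "E (u - t)" "P u (G (P u (y u))) - P' u (G (P' u (y u)))"]
          by (simp add: linear_diff[OF bounded_linear.linear[OF bounded_linear_adjoint_blinfun]])
        also have "\<dots> \<le> e * ((p + p') * \<kappa> * h u * (e * norm x))"
          using diff e u0(2) by (intro mult_mono) auto
        also have "\<dots> = (e * ((p + p') * \<kappa>) * e) * (h u * norm x)" by (simp add: mult_ac)
        also have "\<dots> \<le> C * (h u * norm x)"
          unfolding C_def using h_nonneg[OF u0(1)] by (intro mult_right_mono) auto
        finally show "norm (adjoint (E (u - t)) (P u (G (P u (y u))))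
            - adjoint (E (u - t)) (P' u (G (P' u (y u))))) \<le> C * h u * norm x"
          by (simp add: mult.assoc)
      qed
      also have "\<dots> = (LBINT u:{t..T}. C * h u) * norm x" by simp
      finally show "norm ((P t - P' t) x) \<le> (LBINT u:{t..T}. C * h u) * norm x" .
    qed
  qed
  then show ?thesis by simp
qed

section \<open>Uniqueness for the coupled mean and adjoint equations\<close>

text \<open>
  The difference of two pairs \<open>(z, r)\<close> solves this system with the operators \<open>Qb S\<close> and \<open>QbT ST\<close> in
  the roles of \<open>M\<close> and \<open>MT\<close>. Since the system is coupled in both time directions, a Gronwall
  argument for the pair only works on short intervals; the sign conditions replace it. In the duality
  identity the terms with \<open>P\<close> cancel by symmetry of \<open>P\<close> and \<open>G\<close>, leaving
  \<open>\<langle>MT z(T), z(T)\<rangle> = \<integral> \<langle>G r, r\<rangle> - \<langle>M z, z\<rangle>\<close> over \<open>[0,T]\<close>.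
  The left side is nonpositive and the right side nonnegative, so every term vanishes, and by the kernel
  conditions so do \<open>MT z(T)\<close>, \<open>M z\<close> and \<open>G r\<close>. Every term of the equation of \<open>r\<close> contains one
  of these; what is then left of the equation of \<open>z\<close> is a homogeneous linear Volterra equation.
\<close>

lemma homogeneous_forward_backward_trivial:
  fixes E P :: "real \<Rightarrow> 'h::{real_inner,banach,second_countable_topology} \<Rightarrow>\<^sub>L 'h"
    and M MT :: "'h \<Rightarrow>\<^sub>L 'h"
  assumes T: "T > 0" and E: "\<And>x. continuous_on {0..T} (\<lambda>t. E t x)"
    and P: "\<And>x. continuous_on {0..T} (\<lambda>t. P t x)" "\<And>t. t \<in> {0..T} \<Longrightarrow> selfadjoint (P t)"
    and G: "bounded_linear G" "\<And>x y. G x \<bullet> y = x \<bullet> G y" "\<And>x. 0 \<le> G x \<bullet> x"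
      "\<And>x. G x \<bullet> x = 0 \<Longrightarrow> G x = 0"
    and M: "\<And>x. M x \<bullet> x \<le> 0" "\<And>x. M x \<bullet> x = 0 \<Longrightarrow> M x = 0"
    and MT: "\<And>x. MT x \<bullet> x \<le> 0" "\<And>x. MT x \<bullet> x = 0 \<Longrightarrow> MT x = 0"
    and z: "continuous_on {0..T} z" and r: "continuous_on {0..T} r"
    and z_eq: "\<And>t. t \<in> {0..T} \<Longrightarrow>
      z t = (LBINT u:{0..t}. E (t - u) (- G (P u (z u)) - G (r u)))"
    and r_eq: "\<And>t. t \<in> {0..T} \<Longrightarrow>
      r t = adjoint (E (T - t)) (- MT (z T))
        + (LBINT u:{t..T}. adjoint (E (u - t)) (- P u (G (r u)) - M (z u)))"
    and t: "t \<in> {0..T}"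
  shows "z t = 0" "r t = 0"
proof -
  interpret G: bounded_linear G by fact
  have Pc: "continuous_on {0..T} (\<lambda>u. P u (y u))" if "continuous_on {0..T} y" for y
    by (rule continuous_on_strong_apply[OF compact_Icc P(1) _ _ that]) auto
  define f where "f u = - G (P u (z u)) - G (r u)" for u
  define g where "g u = - P u (G (r u)) - M (z u)" for u
  have f: "continuous_on {0..T} f" and g: "continuous_on {0..T} g"
    unfolding f_def g_def by (intro continuous_intros G.continuous_on Pc z r)+
  define q where "q u = G (r u) \<bullet> r u - M (z u) \<bullet> z u" for u
  have q: "continuous_on {0..T} q"
    unfolding q_def by (intro continuous_intros G.continuous_on z r)
  have q_nonneg: "0 \<le> q u" for u using G(3)[of "r u"] M(1)[of "z u"] by (simp add: q_def)
  have "- MT (z T) \<bullet> z T = (LBINT u:{0..T}. r u \<bullet> f u) - (LBINT u:{0..T}. g u \<bullet> z u)"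
    using T by (intro mild_duality[OF E _ f g r]) (simp_all add: z_eq r_eq f_def g_def)
  also have "\<dots> = (LBINT u:{0..T}. r u \<bullet> f u - g u \<bullet> z u)"
    by (intro set_integral_diff(2)[symmetric] borel_integrable_atLeastAtMost' continuous_intros f g r z)
  also have "\<dots> = (LBINT u:{0..T}. - q u)"
  proof (rule set_lebesgue_integral_cong)
    have "r u \<bullet> f u - g u \<bullet> z u = - q u" if "u \<in> {0..T}" for u
    proof -
      have "P u (G (r u)) \<bullet> z u = G (r u) \<bullet> P u (z u)"
        using P(2)[OF that] by (simp add: selfadjoint_def)
      also have "\<dots> = r u \<bullet> G (P u (z u))" by (rule G(2))
      finally show ?thesis
        by (simp add: f_def g_def q_def inner_diff_left inner_diff_right inner_commute[of "G (r u)"])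
    qed
    then show "\<forall>u. u \<in> {0..T} \<longrightarrow> r u \<bullet> f u - g u \<bullet> z u = - q u" by blast
  qed simp
  also have "\<dots> = - (LBINT u:{0..T}. q u)"
    by (intro set_integral_uminus borel_integrable_atLeastAtMost' q)
  finally have energy: "MT (z T) \<bullet> z T = (LBINT u:{0..T}. q u)" by simp
  then have "q u = 0" if "u \<in> {0..T}" for u
    using set_integral_nonneg_continuous_eq_0[OF q T _ _ that] q_nonneg MT(1)[of "z T"] by simp
  \<comment> \<open>Both summands of \<open>q\<close> are nonnegative, so they vanish separately.\<close>
  then have "G (r u) \<bullet> r u = 0 \<and> M (z u) \<bullet> z u = 0" if "u \<in> {0..T}" for u
    using that G(3)[of "r u"] M(1)[of "z u"] by (fastforce simp: q_def)
  then have Gr: "G (r u) = 0" and Mz: "M (z u) = 0" if "u \<in> {0..T}" for u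
    using that G(4) M(2) by blast+
  have "0 \<le> (LBINT u:{0..T}. q u)"
    unfolding set_lebesgue_integral_def by (simp add: q_nonneg)
  then have MTz: "MT (z T) = 0" using energy MT(1)[of "z T"] MT(2) by simp
  have adj0: "adjoint (E u) 0 = 0" for u
    by (rule linear_0[OF bounded_linear.linear[OF bounded_linear_adjoint_blinfun]])
  have "(LBINT u:{t..T}. adjoint (E (u - t)) (- P u (G (r u)) - M (z u))) = (LBINT u:{t..T}. 0)"
    using t by (intro set_lebesgue_integral_cong) (auto simp: Gr Mz adj0)
  then show "r t = 0"
    using r_eq[OF t] by (simp add: MTz adj0 set_lebesgue_integral_def)
  obtain e where e: "e \<ge> 0" "\<And>t. t \<in> {0..T} \<Longrightarrow> norm (E t) \<le> e"
    by (rule strongly_continuous_bounded[OF compact_Icc E]) blast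
  obtain p where p: "p \<ge> 0" "\<And>t. t \<in> {0..T} \<Longrightarrow> norm (P t) \<le> p"
    by (rule strongly_continuous_bounded[OF compact_Icc P(1)]) blast
  obtain \<kappa> where \<kappa>: "\<And>x. norm (G x) \<le> norm x * \<kappa>" "\<kappa> \<ge> 0"
    using G.nonneg_bounded by blast
  obtain K where "\<forall>u\<in>{0..T}. norm (z u) \<le> K"
    using compact_imp_bounded[OF compact_continuous_image[OF z compact_Icc]]
    by (auto simp: bounded_iff)
  then have K: "norm (z u) \<le> K" if "u \<in> {0..T}" for u using that by blast
  have nonneg: "0 \<le> e * (p * \<kappa>)" using e p \<kappa> by simp
  have "norm (z t) \<le> 0"
  proof (rule gronwall_forward[where \<Phi>="\<lambda>t. norm (z t)" and C="e * (p * \<kappa>) + 1", OF K _ _ t])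
    show "0 < e * (p * \<kappa>) + 1" using nonneg by simp
    fix h t assume h: "continuous_on {0..T} h" "\<And>u. u \<in> {0..T} \<Longrightarrow> norm (z u) \<le> h u"
      and t: "t \<in> {0..T}"
    show "norm (z t) \<le> (LBINT u:{0..t}. (e * (p * \<kappa>) + 1) * h u)"
      unfolding z_eq[OF t]
    proof (rule norm_set_integral_le)
      show "set_integrable lborel {0..t} (\<lambda>u. (e * (p * \<kappa>) + 1) * h u)"
        by (intro borel_integrable_atLeastAtMost' continuous_intros continuous_on_subset[OF h(1)])
          (use t in auto)
      fix u assume "u \<in> {0..t}"
      then have u: "u \<in> {0..T}" "t - u \<in> {0..T}" using t by auto
      have "norm (P u (z u)) \<le> p * norm (z u)"
        using norm_blinfun[of "P u" "z u"] p(2)[OF u(1)] by (meson mult_right_mono norm_ge_zero order_trans)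
      then have "norm (G (P u (z u))) \<le> p * norm (z u) * \<kappa>"
        using \<kappa> by (meson mult_right_mono order_trans)
      then have "norm (E (t - u) (- G (P u (z u)) - G (r u))) \<le> e * (p * norm (z u) * \<kappa>)"
        using norm_blinfun[of "E (t - u)" "- G (P u (z u))"] e(2)[OF u(2)] e(1)
        by (simp add: Gr[OF u(1)]) (meson mult_mono norm_ge_zero order_trans)
      also have "\<dots> = e * (p * \<kappa>) * norm (z u)" by (simp add: mult_ac)
      also have "\<dots> \<le> (e * (p * \<kappa>) + 1) * h u"
        using nonneg h(2)[OF u(1)] by (intro mult_mono) auto
      finally show "norm (E (t - u) (- G (P u (z u)) - G (r u))) \<le> (e * (p * \<kappa>) + 1) * h u" .
    qed
  qed
  then show "z t = 0" by simp
qed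

text \<open>
  Collecting the integrals of a mild equation into a single convolution, whose integrability is
  needed to subtract the equations of two solutions.
\<close>

lemma mean_mild_equation_convolution:
  fixes E P :: "real \<Rightarrow> 'h::{real_inner,banach,second_countable_topology} \<Rightarrow>\<^sub>L 'h"
  assumes E: "\<And>x. continuous_on {0..T} (\<lambda>t. E t x)" and P: "\<And>x. continuous_on {0..T} (\<lambda>t. P t x)"
    and G: "bounded_linear (BRB B R)"
    and z: "continuous_on {0..T} z" and r: "continuous_on {0..T} r"
    and eq: "mean_mild_equation E B R T z0 P r z" and t: "t \<in> {0..T}"
  shows "set_integrable lborel {0..t} (\<lambda>u. E (t - u) (- BRB B R (P u (z u)) - BRB B R (r u)))"
    and "z t = E t z0 + (LBINT u:{0..t}. E (t - u) (- BRB B R (P u (z u)) - BRB B R (r u)))"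
proof -
  have zt: "continuous_on {0..t} z" and rt: "continuous_on {0..t} r"
    using t by (auto intro: continuous_on_subset[OF z] continuous_on_subset[OF r])
  have Pz: "continuous_on {0..t} (\<lambda>u. P u (z u))"
    by (rule continuous_on_strong_apply[OF compact_Icc P _ _ zt]) (use t in \<open>auto intro: continuous_intros\<close>)
  note cont = bounded_linear.continuous_on[OF G Pz] bounded_linear.continuous_on[OF G rt]
  have int1: "set_integrable lborel {0..t} (\<lambda>u. E (t - u) (BRB B R (P u (z u))))"
    using t by (intro set_integrable_convolution[OF E] cont) simp
  have int2: "set_integrable lborel {0..t} (\<lambda>u. E (t - u) (BRB B R (r u)))"
    using t by (intro set_integrable_convolution[OF E] cont) simp
  have eq': "E (t - u) (- BRB B R (P u (z u)) - BRB B R (r u))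
      = - (E (t - u) (BRB B R (P u (z u))) + E (t - u) (BRB B R (r u)))" for u
    by (simp add: blinfun.diff_right blinfun.minus_right)
  have int: "set_integrable lborel {0..t} (\<lambda>u. E (t - u) (BRB B R (P u (z u))) + E (t - u) (BRB B R (r u)))"
    by (intro set_integral_add(1) int1 int2)
  show "set_integrable lborel {0..t} (\<lambda>u. E (t - u) (- BRB B R (P u (z u)) - BRB B R (r u)))"
    using t by (intro set_integrable_convolution[OF E] continuous_intros cont) simp
  show "z t = E t z0 + (LBINT u:{0..t}. E (t - u) (- BRB B R (P u (z u)) - BRB B R (r u)))"
    unfolding eq' set_integral_uminus[OF int] set_integral_add(2)[OF int1 int2]
    using eq t by (simp add: mean_mild_equation_def)
qed

lemma adjoint_mild_equation_convolution:
  fixes E P :: "real \<Rightarrow> 'h::{real_inner,banach,second_countable_topology} \<Rightarrow>\<^sub>L 'h"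
  assumes E: "\<And>x. continuous_on {0..T} (\<lambda>t. E t x)" and P: "\<And>x. continuous_on {0..T} (\<lambda>t. P t x)"
    and G: "bounded_linear (BRB B R)"
    and z: "continuous_on {0..T} z" and r: "continuous_on {0..T} r"
    and eq: "adjoint_mild_equation E B R Qb QbT S ST T P r z" and t: "t \<in> {0..T}"
  shows "set_integrable lborel {t..T} (\<lambda>u. adjoint (E (u - t)) (- P u (BRB B R (r u)) - Qb (S (z u))))"
    and "r t = adjoint (E (T - t)) (- QbT (ST (z T)))
      + (LBINT u:{t..T}. adjoint (E (u - t)) (- P u (BRB B R (r u)) - Qb (S (z u))))"
proof -
  have lin: "linear (adjoint (E u))" for u
    by (rule bounded_linear.linear[OF bounded_linear_adjoint_blinfun])
  have zt: "continuous_on {t..T} z" and rt: "continuous_on {t..T} r"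
    using t by (auto intro: continuous_on_subset[OF z] continuous_on_subset[OF r])
  have PGr: "continuous_on {t..T} (\<lambda>u. P u (BRB B R (r u)))"
    by (rule continuous_on_strong_apply[OF compact_Icc P _ _ bounded_linear.continuous_on[OF G rt]])
      (use t in \<open>auto intro: continuous_intros\<close>)
  have int1: "set_integrable lborel {t..T} (\<lambda>u. adjoint (E (u - t)) (P u (BRB B R (r u))))"
    using t by (intro set_integrable_adjoint_convolution[OF E] PGr) simp
  have int2: "set_integrable lborel {t..T} (\<lambda>u. adjoint (E (u - t)) (Qb (S (z u))))"
    using t by (intro set_integrable_adjoint_convolution[OF E] continuous_intros zt) simp
  have eq': "adjoint (E (u - t)) (- P u (BRB B R (r u)) - Qb (S (z u)))
      = - (adjoint (E (u - t)) (P u (BRB B R (r u))) + adjoint (E (u - t)) (Qb (S (z u))))" for u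
    by (simp add: linear_diff[OF lin] linear_neg[OF lin])
  have int: "set_integrable lborel {t..T}
      (\<lambda>u. adjoint (E (u - t)) (P u (BRB B R (r u))) + adjoint (E (u - t)) (Qb (S (z u))))"
    by (intro set_integral_add(1) int1 int2)
  show "set_integrable lborel {t..T} (\<lambda>u. adjoint (E (u - t)) (- P u (BRB B R (r u)) - Qb (S (z u))))"
    using t by (intro set_integrable_adjoint_convolution[OF E] continuous_intros PGr zt) simp
  show "r t = adjoint (E (T - t)) (- QbT (ST (z T)))
      + (LBINT u:{t..T}. adjoint (E (u - t)) (- P u (BRB B R (r u)) - Qb (S (z u))))"
    unfolding eq' set_integral_uminus[OF int] set_integral_add(2)[OF int1 int2]
    using eq t by (simp add: adjoint_mild_equation_def linear_neg[OF lin])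
qed

theorem theorem4p2:
  fixes D :: "'h::{real_inner,banach,second_countable_topology} set"
    and A :: "'h \<Rightarrow> 'h"
    and E :: "real \<Rightarrow> 'h \<Rightarrow>\<^sub>L 'h"
    and B :: "'u::{real_inner,banach,second_countable_topology} \<Rightarrow>\<^sub>L 'h"
    and R :: "'u \<Rightarrow>\<^sub>L 'u"
    and Q QT Qb QbT S ST :: "'h \<Rightarrow>\<^sub>L 'h"
    and \<sigma> :: "'k::{real_inner,banach,second_countable_topology} \<Rightarrow>\<^sub>L 'h"
    and T :: real
    and z0 :: 'h
    and P P' :: "real \<Rightarrow> 'h \<Rightarrow>\<^sub>L 'h"
    and r r' z z' :: "real \<Rightarrow> 'h"
    and s s' :: "real \<Rightarrow> real"
  assumes "linear_operator_on D A" "closed_operator D A" "closure D = UNIV"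
    and "C0_semigroup E" "generates D A E"
    and "nonneg_selfadjoint Q" "nonneg_selfadjoint QT"
    and "selfadjoint Qb" "selfadjoint QbT"
    and "nonneg_selfadjoint (Q + Qb)" "nonneg_selfadjoint (QT + QbT)"
    and "selfadjoint R" "\<exists>\<epsilon>>0. \<forall>\<alpha>. R \<alpha> \<bullet> \<alpha> \<ge> \<epsilon> * (norm \<alpha>)\<^sup>2"
    and "T > 0"
    and "nonneg_selfadjoint (- (QbT o\<^sub>L ST))" "nonneg_selfadjoint (- (Qb o\<^sub>L S))"
    and "\<And>x. QbT (ST x) \<bullet> x = 0 \<Longrightarrow> QbT (ST x) = 0"
    and "\<And>x. Qb (S x) \<bullet> x = 0 \<Longrightarrow> Qb (S x) = 0"
    and "LQM_mild_solution E B R Q QT Qb QbT S ST \<sigma> T z0 P r z s"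
    and "LQM_mild_solution E B R Q QT Qb QbT S ST \<sigma> T z0 P' r' z' s'"
  shows "\<forall>t\<in>{0..T}. P t = P' t \<and> r t = r' t \<and> z t = z' t \<and> s t = s' t"
proof -
  note sol = assms(19)[unfolded LQM_mild_solution_def]
  note sol' = assms(20)[unfolded LQM_mild_solution_def]
  have E: "continuous_on {0..T} (\<lambda>t. E t x)" for x
    using assms(4) by (auto simp: C0_semigroup_def intro: continuous_on_subset[of "{0..}"])
  have P: "continuous_on {0..T} (\<lambda>t. P t x)" and P': "continuous_on {0..T} (\<lambda>t. P' t x)" for x
    using sol sol' by auto
  have P_sym: "selfadjoint (P t)" if "t \<in> {0..T}" for t
    using sol that by (auto simp: nonneg_selfadjoint_def)
  have z: "continuous_on {0..T} z" and z': "continuous_on {0..T} z'"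
    and r: "continuous_on {0..T} r" and r': "continuous_on {0..T} r'"
    using sol sol' by auto
  obtain \<epsilon> where \<epsilon>: "\<epsilon> > 0" "\<And>\<alpha>. \<epsilon> * (norm \<alpha>)\<^sup>2 \<le> R \<alpha> \<bullet> \<alpha>" using assms(13) by blast
  note G = BRB_control_operator[of R \<epsilon> B, OF assms(12) \<epsilon>]
  have PP': "P t = P' t" if "t \<in> {0..T}" for t
  proof (rule riccati_unique[OF E G(1) P P' _ _ that])
    fix t x assume "t \<in> {0..T}"
    then show "P t x = (adjoint (E (T - t)) ((QT + QbT) (E (T - t) x))
          + (LBINT u:{t..T}. adjoint (E (u - t)) ((Q + Qb) (E (u - t) x))))
          - (LBINT u:{t..T}. adjoint (E (u - t)) (P u (BRB B R (P u (E (u - t) x)))))"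
      and "P' t x = (adjoint (E (T - t)) ((QT + QbT) (E (T - t) x))
          + (LBINT u:{t..T}. adjoint (E (u - t)) ((Q + Qb) (E (u - t) x))))
          - (LBINT u:{t..T}. adjoint (E (u - t)) (P' u (BRB B R (P' u (E (u - t) x)))))"
      using sol sol' by (simp_all add: riccati_mild_solution_def)
  qed
  have mean': "mean_mild_equation E B R T z0 P r' z'"
  proof -
    have "(LBINT u:{0..t}. E (t - u) (BRB B R (P u (z' u))))
        = (LBINT u:{0..t}. E (t - u) (BRB B R (P' u (z' u))))" if "t \<in> {0..T}" for t
      using that by (intro set_lebesgue_integral_cong) (auto simp: PP')
    then show ?thesis using sol' by (simp add: mean_mild_equation_def)
  qed
  have adj': "adjoint_mild_equation E B R Qb QbT S ST T P r' z'"
  proof -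
    have "(LBINT u:{t..T}. adjoint (E (u - t)) (P u (BRB B R (r' u))))
        = (LBINT u:{t..T}. adjoint (E (u - t)) (P' u (BRB B R (r' u))))" if "t \<in> {0..T}" for t
      using that by (intro set_lebesgue_integral_cong) (auto simp: PP')
    then show ?thesis using sol' by (simp add: adjoint_mild_equation_def)
  qed
  have mean: "mean_mild_equation E B R T z0 P r z"
    and adj: "adjoint_mild_equation E B R Qb QbT S ST T P r z" using sol by auto
  note G_diff = linear_diff[OF bounded_linear.linear[OF G(1)]]
  have z_diff: "z t - z' t = (LBINT u:{0..t}. E (t - u)
      (- BRB B R (P u (z u - z' u)) - BRB B R (r u - r' u)))" if t: "t \<in> {0..T}" for t
  proof -
    note I = mean_mild_equation_convolution[OF E P G(1) z r mean t]
    note I' = mean_mild_equation_convolution[OF E P G(1) z' r' mean' t]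
    have "z t - z' t = (LBINT u:{0..t}. E (t - u) (- BRB B R (P u (z u)) - BRB B R (r u))
        - E (t - u) (- BRB B R (P u (z' u)) - BRB B R (r' u)))"
      unfolding set_integral_diff(2)[OF I(1) I'(1)] I(2) I'(2) by simp
    also have "\<dots> = (LBINT u:{0..t}. E (t - u)
      (- BRB B R (P u (z u - z' u)) - BRB B R (r u - r' u)))"
      by (simp add: blinfun.add_right blinfun.diff_right blinfun.minus_right G_diff algebra_simps)
    finally show ?thesis .
  qed
  have r_diff: "r t - r' t = adjoint (E (T - t)) (- (QbT o\<^sub>L ST) (z T - z' T))
      + (LBINT u:{t..T}. adjoint (E (u - t))
        (- P u (BRB B R (r u - r' u)) - (Qb o\<^sub>L S) (z u - z' u)))" if t: "t \<in> {0..T}" for t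
  proof -
    note I = adjoint_mild_equation_convolution[OF E P G(1) z r adj t]
    note I' = adjoint_mild_equation_convolution[OF E P G(1) z' r' adj' t]
    note adj_simps = linear_add[OF bounded_linear.linear[OF bounded_linear_adjoint_blinfun]]
      linear_diff[OF bounded_linear.linear[OF bounded_linear_adjoint_blinfun]]
      linear_neg[OF bounded_linear.linear[OF bounded_linear_adjoint_blinfun]]
    have "r t - r' t = adjoint (E (T - t)) (- (QbT o\<^sub>L ST) (z T - z' T))
      + (LBINT u:{t..T}. adjoint (E (u - t)) (- P u (BRB B R (r u)) - Qb (S (z u)))
        - adjoint (E (u - t)) (- P u (BRB B R (r' u)) - Qb (S (z' u))))"
      unfolding set_integral_diff(2)[OF I(1) I'(1)] I(2) I'(2)
      by (simp add: adj_simps blinfun.diff_right algebra_simps)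
    also have "(LBINT u:{t..T}. adjoint (E (u - t)) (- P u (BRB B R (r u)) - Qb (S (z u)))
        - adjoint (E (u - t)) (- P u (BRB B R (r' u)) - Qb (S (z' u))))
      = (LBINT u:{t..T}. adjoint (E (u - t))
        (- P u (BRB B R (r u - r' u)) - (Qb o\<^sub>L S) (z u - z' u)))"
      by (simp add: adj_simps blinfun.diff_right G_diff algebra_simps)
    finally show ?thesis .
  qed
  have M: "(Qb o\<^sub>L S) x \<bullet> x \<le> 0" "(QbT o\<^sub>L ST) x \<bullet> x \<le> 0" for x
    using assms(15,16) by (auto simp: nonneg_selfadjoint_def blinfun.minus_left)
  have M_ker: "(Qb o\<^sub>L S) x \<bullet> x = 0 \<Longrightarrow> (Qb o\<^sub>L S) x = 0"
    "(QbT o\<^sub>L ST) x \<bullet> x = 0 \<Longrightarrow> (QbT o\<^sub>L ST) x = 0" for x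
    using assms(17,18) by simp_all
  note trivial = homogeneous_forward_backward_trivial[where z="\<lambda>t. z t - z' t" and r="\<lambda>t. r t - r' t",
      OF assms(14) E P P_sym G M(1) M_ker(1) M(2) M_ker(2)
        continuous_on_diff[OF z z'] continuous_on_diff[OF r r'] z_diff r_diff]
  have zz': "z t = z' t" and rr': "r t = r' t" if "t \<in> {0..T}" for t
    using trivial[of t] that by simp_all
  have "s t = s' t" if t: "t \<in> {0..T}" for t
  proof -
    have "(LBINT u:{t..T}. 1/2 * op_trace (\<lambda>x. \<sigma> (adjoint \<sigma> (P u x)))
          - 1/2 * (BRB B R (r u) \<bullet> r u) + 1/2 * (Qb (S (z u)) \<bullet> S (z u)))
        = (LBINT u:{t..T}. 1/2 * op_trace (\<lambda>x. \<sigma> (adjoint \<sigma> (P' u x)))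
          - 1/2 * (BRB B R (r' u) \<bullet> r' u) + 1/2 * (Qb (S (z' u)) \<bullet> S (z' u)))"
      using t by (intro set_lebesgue_integral_cong) (auto simp: PP' zz' rr')
    moreover have "z T = z' T" using assms(14) by (intro zz') simp
    ultimately show ?thesis
      using sol sol' t by (simp only: scalar_equation_def)
  qed
  with PP' zz' rr' show ?thesis by blast
qed

end
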